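(* Let $N$ be an ordered negative support family for $\mathbf v_0$, and let $C_{\mathbf v_0,N}\subset\mathbb C[\mathbf y]$ be the coefficient space, $\mathfrak Q_N\subset\mathbb C[\partial_{\mathbf y}]$ the ideal and $\mathfrak m_N\in\mathbb C[\partial_{\mathbf y}]$ the monomial defined in the context. Then the annihilator of $C_{\mathbf v_0,N}$ is $$\operatorname{Ann}^{\bullet}_{\mathbb C[\partial_{\mathbf y}]}(C_{\mathbf v_0,N})=\mathfrak Q_N:\mathfrak m_N,$$ and $$C_{\mathbf v_0,N}=(\mathfrak Q_N:\mathfrak m_N)^{\perp,\mathbb C[\mathbf y]}=\operatorname{Sol}^{\bullet}_{\mathbb C[\mathbf y]}(\mathfrak Q_N:\mathfrak m_N).$$
   Context: $\mathbb N$ is the set of nonnegative integers. Let $A=(\mathbf a_1,\dots,\mathbf a_n)=(a_{ij})$ be a $d\times n$ integer matrix of rank $d$ whose columns all lie in a single affine hyperplane of $\mathbb Q^d$ not passing through the origin. Put $L=\operatorname{Ker}_{\mathbb Z}(A)\subset\mathbb Z^n$. The toric ideal is $I_A=\langle\partial_{\mathbf x}^{\mathbf u}-\partial_{\mathbf x}^{\mathbf v}\mid A\mathbf u=A\mathbf v,\ \mathbf u,\mathbf v\in\mathbb N^n\rangle\subset\mathbb C[\partial_1,\dots,\partial_n]$. For $\boldsymbol\beta\in\mathbb C^d$, $H_A(\boldsymbol\beta)$ is the left ideal of the Weyl algebra $D=\mathbb C\langle x_1,\dots,x_n,\partial_1,\dots,\partial_n\rangle$ generated by $I_A$ and the Euler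 operators $\sum_j a_{ij}\theta_j-\beta_i$ ($1\le i\le d$), $\theta_j=x_j\partial_j$. Fix a generic weight $\mathbf w\in\mathbb R^n$, i.e. such that the initial ideal $\operatorname{in}_{\mathbf w}(I_A)$ (generated by the parts of maximal $\mathbf w$-weight of elements of $I_A$, $\partial_j$ having weight $w_j$) is a monomial ideal. A fake exponent of $H_A(\boldsymbol\beta)$ with respect to $\mathbf w$ is a zero in $\mathbb C^n$ of the ideal $(D\operatorname{in}_{\mathbf w}(I_A)\cap\mathbb C[\boldsymbol\theta])+\langle A\boldsymbol\theta-\boldsymbol\beta\rangle\subset\mathbb C[\boldsymbol\theta]$, $\boldsymbol\theta=(\theta_1,\dots,\theta_n)$. Fix a fake exponent $\mathbf v_0$. For $\mathbf v\in\mathbb C^n$ let $\operatorname{nsupp}(\mathbf v)=\{j\mid v_j\in\mathbb Z_{<0}\}$. For $\mathbf u\in L$ put $I_{\mathbf u}=\operatorname{nsupp}(\mathbf v_0+\mathbf u)$; put $\mathrm{NS}=\{I_{\mathbf u}\mid\mathbf u\in L\}$ and $\mathcal N_{\mathbf v_0}=\{I\in\mathrm{NS}\mid \mathbf w\cdot\mathbf u\ge0\text{ for every }\mathbf u\in L\text{ with }I_{\mathbf u}=I\}$. A negative support family for $\mathbf v_0$ is a set $N$ with $I_{\mathbf 0}\in N\subset\mathcal N_{\mathbf v_0}$; it is ordered if $I\in N$, $J\in\mathrm{NS}$, $J\subset I$ imply $J\in N$. Put $N^c=\mathrm{NS}\setminus N$ and $K_N=\bigcap_{I\in N}I$. Let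 $\mathbf y=(y_1,\dots,y_n)$ be variables (representing $\log\mathbf x=(\log x_1,\dots,\log x_n)$). $C_{\mathbf v_0,N}$ is the space of all polynomials $r_{\mathbf 0}(\mathbf y)$ occurring as the coefficient of $\mathbf x^{\mathbf v_0}$ in a formal logarithmic series $\sum_{\mathbf u\in L,\,I_{\mathbf u}\in N}\mathbf x^{\mathbf v_0+\mathbf u}r_{\mathbf u}(\log\mathbf x)$, $r_{\mathbf u}\in\mathbb C[\mathbf y]$, annihilated by $H_A(\boldsymbol\beta)$ (termwise formal action). For $S\subset\{1,\dots,n\}$ put $\partial_{\mathbf y}^S=\prod_{j\in S}\partial_{y_j}$ (empty product $=1$). In $\mathbb C[\partial_{\mathbf y}]$ define $\mathfrak m_N=\partial_{\mathbf y}^{I_{\mathbf 0}\setminus K_N}$, $\mathfrak M_N=\langle\partial_{\mathbf y}^{I\setminus K_N}\mid I\in N\rangle$, $\mathfrak P_N=\langle\partial_{\mathbf y}^{(I\cup J)\setminus K_N}\mid I\in N,\ J\in N^c\rangle$, $\langle A\partial_{\mathbf y}\rangle=\langle\sum_j a_{ij}\partial_{y_j}\mid 1\le i\le d\rangle$, and $\mathfrak Q_N=\langle A\partial_{\mathbf y}\rangle\mathfrak M_N+\mathfrak P_N$. $\bullet$ denotes the usual action of constant-coefficient differential operators on polynomials. For $W\subset\mathbb C[\mathbf y]$, $\operatorname{Ann}^\bullet_{\mathbb C[\partial_{\mathbf y}]}(W)=\{f\mid f\bullet w=0\ \forall w\in W\}$. For an ideal $J\subset\mathbb C[\partial_{\mathbf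 y}]$, $\operatorname{Sol}^\bullet_{\mathbb C[\mathbf y]}(J)=\{p\in\mathbb C[\mathbf y]\mid f\bullet p=0\ \forall f\in J\}$ and $J^{\perp,\mathbb C[\mathbf y]}=\{p\in\mathbb C[\mathbf y]\mid (f\bullet p)|_{\mathbf y=\mathbf 0}=0\ \forall f\in J\}$. $J:m=\{f\mid fm\in J\}$. *)

theory Defs
  imports "HOL-Analysis.Analysis" "HOL-Library.Poly_Mapping"
begin

section \<open>Commutative polynomial rings\<close>

text \<open>
  The type \<open>'n cpoly\<close> serves for each of the rings \<open>\<complex>[\<partial>\<^sub>1,\<dots>,\<partial>\<^sub>n]\<close>, \<open>\<complex>[\<theta>]\<close>, \<open>\<complex>[y]\<close> and
  \<open>\<complex>[\<partial>\<^sub>y]\<close>; the index set \<open>{1,\<dots>,n}\<close> is the finite type \<open>'n\<close>. The ring structure is that of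
  \<open>HOL-Library.Poly_Mapping\<close>.
\<close>

type_synonym 'n cpoly = "(nat^'n) \<Rightarrow>\<^sub>0 complex"

definition mon :: "nat^'n \<Rightarrow> 'n::finite cpoly"
  where "mon u = Poly_Mapping.single u 1"

definition cpoly_const :: "complex \<Rightarrow> 'n::finite cpoly"
  where "cpoly_const c = Poly_Mapping.single 0 c"

definition var :: "'n \<Rightarrow> 'n::finite cpoly"
  where "var j = mon (axis j 1)"

definition sqfree_mon :: "'n set \<Rightarrow> 'n::finite cpoly"
  where "sqfree_mon S = (\<Prod>j\<in>S. var j)"

definition poly_eval :: "'n::finite cpoly \<Rightarrow> complex^'n \<Rightarrow> complex"
  where "poly_eval f v =
    (\<Sum>u\<in>Poly_Mapping.keys f. Poly_Mapping.lookup f u * (\<Prod>j\<in>UNIV. (v $ j) ^ (u $ j)))"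

definition ideal_gen :: "'n::finite cpoly set \<Rightarrow> 'n cpoly set"
  where "ideal_gen S = module.span (*) S"

definition ideal_sum :: "'n::finite cpoly set \<Rightarrow> 'n cpoly set \<Rightarrow> 'n cpoly set"
  where "ideal_sum I J = {f + g | f g. f \<in> I \<and> g \<in> J}"

definition ideal_prod :: "'n::finite cpoly set \<Rightarrow> 'n cpoly set \<Rightarrow> 'n cpoly set"
  where "ideal_prod I J = ideal_gen {f * g | f g. f \<in> I \<and> g \<in> J}"

definition ideal_colon :: "'n::finite cpoly set \<Rightarrow> 'n cpoly \<Rightarrow> 'n cpoly set"
  where "ideal_colon J m = {f. f * m \<in> J}"


section \<open>Constant-coefficient differential operators on polynomials\<close>

text \<open>
  \<open>\<partial>\<^sup>b y\<^sup>a = (\<Prod>\<^sub>j a\<^sub>j (a\<^sub>j - 1) \<cdots> (a\<^sub>j - b\<^sub>j + 1)) y\<^sup>a\<^sup>-\<^sup>b\<close>. When \<open>b \<le> a\<close> fails, the product has a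
  factor \<open>0\<close>, so that the truncated difference \<open>a - b\<close> is harmless.
\<close>

definition diff_act :: "'n::finite cpoly \<Rightarrow> 'n cpoly \<Rightarrow> 'n cpoly"  (infixr \<open>\<rhd>\<close> 75)
  where "f \<rhd> p = (\<Sum>b\<in>Poly_Mapping.keys f. \<Sum>a\<in>Poly_Mapping.keys p.
    Poly_Mapping.single (a - b)
      (Poly_Mapping.lookup f b * Poly_Mapping.lookup p a *
        (\<Prod>j\<in>UNIV. \<Prod>i<b $ j. of_nat (a $ j) - of_nat i)))"

definition annihilator :: "'n::finite cpoly set \<Rightarrow> 'n cpoly set"
  where "annihilator W = {f. \<forall>p\<in>W. f \<rhd> p = 0}"

definition sol_space :: "'n::finite cpoly set \<Rightarrow> 'n cpoly set"
  where "sol_space J = {p. \<forall>f\<in>J. f \<rhd> p = 0}"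

definition perp_space :: "'n::finite cpoly set \<Rightarrow> 'n cpoly set"
  where "perp_space J = {p. \<forall>f\<in>J. poly_eval (f \<rhd> p) 0 = 0}"


section \<open>The Weyl algebra\<close>

text \<open>
  An element of the Weyl algebra is represented by its normally ordered form: the coefficient at
  \<open>(a, b)\<close> is that of \<open>x\<^sup>a \<partial>\<^sup>b\<close>. The product of \<open>D\<close> is \<open>weyl_mult\<close>, given by the Leibniz formula
  \<open>\<partial>\<^sup>b x\<^sup>c = \<Sum>\<^sub>k (\<Prod>\<^sub>j (b\<^sub>j choose k\<^sub>j) (c\<^sub>j choose k\<^sub>j) k\<^sub>j!) x\<^sup>c\<^sup>-\<^sup>k \<partial>\<^sup>b\<^sup>-\<^sup>k\<close>, and \<^emph>\<open>not\<close> the commutative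
  product \<open>(*)\<close> that the type carries as well; only addition is taken from the library.
\<close>

type_synonym 'n weyl = "((nat^'n) \<times> (nat^'n)) \<Rightarrow>\<^sub>0 complex"

definition weyl_mult :: "'n::finite weyl \<Rightarrow> 'n weyl \<Rightarrow> 'n weyl"  (infixl \<open>\<star>\<close> 70)
  where "P \<star> Q = (\<Sum>(a, b)\<in>Poly_Mapping.keys P. \<Sum>(c, d)\<in>Poly_Mapping.keys Q.
    \<Sum>k | k \<le> b \<and> k \<le> c.
      Poly_Mapping.single (a + c - k, b + d - k)
        (Poly_Mapping.lookup P (a, b) * Poly_Mapping.lookup Q (c, d) *
          of_nat (\<Prod>j\<in>UNIV. (b $ j choose k $ j) * (c $ j choose k $ j) * fact (k $ j))))"

definition weyl_const :: "complex \<Rightarrow> 'n::finite weyl"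
  where "weyl_const c = Poly_Mapping.single (0, 0) c"

definition weyl_x :: "'n \<Rightarrow> 'n::finite weyl"
  where "weyl_x j = Poly_Mapping.single (axis j 1, 0) 1"

definition weyl_d :: "'n \<Rightarrow> 'n::finite weyl"
  where "weyl_d j = Poly_Mapping.single (0, axis j 1) 1"

definition weyl_theta :: "'n \<Rightarrow> 'n::finite weyl"
  where "weyl_theta j = weyl_x j \<star> weyl_d j"

definition weyl_of_diff :: "'n::finite cpoly \<Rightarrow> 'n weyl"
  \<comment> \<open>the inclusion of \<open>\<complex>[\<partial>\<^sub>1,\<dots>,\<partial>\<^sub>n]\<close> into \<open>D\<close>\<close>
  where "weyl_of_diff f =
    (\<Sum>b\<in>Poly_Mapping.keys f. Poly_Mapping.single (0, b) (Poly_Mapping.lookup f b))"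

inductive_set left_ideal_gen :: "'n::finite weyl set \<Rightarrow> 'n weyl set"
  for S :: "'n weyl set"
  where
    zero: "0 \<in> left_ideal_gen S"
  | gen: "P \<in> S \<Longrightarrow> P \<in> left_ideal_gen S"
  | add: "P \<in> left_ideal_gen S \<Longrightarrow> Q \<in> left_ideal_gen S \<Longrightarrow> P + Q \<in> left_ideal_gen S"
  | mult: "Q \<in> left_ideal_gen S \<Longrightarrow> P \<star> Q \<in> left_ideal_gen S"

text \<open>
  \<open>theta_eval f P\<close> is the graph of the ring embedding \<open>\<complex>[\<theta>] \<rightarrow> D\<close>, \<open>\<theta>\<^sub>j \<mapsto> x\<^sub>j \<partial>\<^sub>j\<close>: here
  \<open>f\<close> is a polynomial in \<open>n\<close> variables and \<open>P = f(\<theta>\<^sub>1,\<dots>,\<theta>\<^sub>n)\<close>.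
\<close>

inductive theta_eval :: "'n::finite cpoly \<Rightarrow> 'n weyl \<Rightarrow> bool"
  where
    const: "theta_eval (cpoly_const c) (weyl_const c)"
  | var: "theta_eval (var j) (weyl_theta j)"
  | add: "theta_eval f P \<Longrightarrow> theta_eval g Q \<Longrightarrow> theta_eval (f + g) (P + Q)"
  | mult: "theta_eval f P \<Longrightarrow> theta_eval g Q \<Longrightarrow> theta_eval (f * g) (P \<star> Q)"


section \<open>A-hypergeometric systems\<close>

definition int_vec :: "nat^'n \<Rightarrow> int^'n::finite"
  where "int_vec u = (\<chi> j. int (u $ j))"

definition complex_vec :: "int^'n \<Rightarrow> complex^'n::finite"
  where "complex_vec u = (\<chi> j. of_int (u $ j))"

definition real_vec :: "int^'n \<Rightarrow> real^'n::finite"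
  where "real_vec u = (\<chi> j. of_int (u $ j))"

definition admissible_matrix :: "int^'n::finite^'d::finite \<Rightarrow> bool"
  where "admissible_matrix A \<longleftrightarrow>
    rank (map_matrix rat_of_int A) = CARD('d) \<and>
    (\<exists>(h :: rat^'d) c. h \<noteq> 0 \<and> c \<noteq> 0 \<and> (\<forall>j. (\<Sum>i\<in>UNIV. h $ i * of_int (A $ i $ j)) = c))"

definition ker_lattice :: "int^'n::finite^'d::finite \<Rightarrow> (int^'n) set"
  where "ker_lattice A = {u. A *v u = 0}"

definition toric_ideal :: "int^'n::finite^'d::finite \<Rightarrow> 'n cpoly set"
  where "toric_ideal A = ideal_gen {mon u - mon v | u v. A *v int_vec u = A *v int_vec v}"

definition euler_op :: "int^'n::finite^'d::finite \<Rightarrow> complex^'d \<Rightarrow> 'd \<Rightarrow> 'n weyl"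
  where "euler_op A \<beta> i =
    (\<Sum>j\<in>UNIV. weyl_const (of_int (A $ i $ j)) \<star> weyl_theta j) - weyl_const (\<beta> $ i)"

definition hypergeometric_ideal :: "int^'n::finite^'d::finite \<Rightarrow> complex^'d \<Rightarrow> 'n weyl set"
  where "hypergeometric_ideal A \<beta> =
    left_ideal_gen (weyl_of_diff ` toric_ideal A \<union> range (euler_op A \<beta>))"


section \<open>Initial ideals and fake exponents\<close>

definition initial_form :: "real^'n::finite \<Rightarrow> 'n cpoly \<Rightarrow> 'n cpoly"
  where "initial_form w f =
    (let wt = (\<lambda>u. w \<bullet> real_vec (int_vec u)) in
      \<Sum>u | u \<in> Poly_Mapping.keys f \<and> wt u = Max (wt ` Poly_Mapping.keys f).
        Poly_Mapping.single u (Poly_Mapping.lookup f u))"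

definition initial_ideal :: "real^'n::finite \<Rightarrow> 'n cpoly set \<Rightarrow> 'n cpoly set"
  where "initial_ideal w I = ideal_gen (initial_form w ` I)"

definition monomial_ideal :: "'n::finite cpoly set \<Rightarrow> bool"
  where "monomial_ideal I \<longleftrightarrow> (\<exists>M. I = ideal_gen (mon ` M))"

definition generic_weight :: "int^'n::finite^'d::finite \<Rightarrow> real^'n \<Rightarrow> bool"
  where "generic_weight A w \<longleftrightarrow> monomial_ideal (initial_ideal w (toric_ideal A))"

definition fake_indicial_ideal ::
    "int^'n::finite^'d::finite \<Rightarrow> complex^'d \<Rightarrow> real^'n \<Rightarrow> 'n cpoly set"
  where "fake_indicial_ideal A \<beta> w = ideal_sum
    {f. \<exists>P \<in> left_ideal_gen (weyl_of_diff ` initial_ideal w (toric_ideal A)). theta_eval f P}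
    (ideal_gen {(\<Sum>j\<in>UNIV. cpoly_const (of_int (A $ i $ j)) * var j) - cpoly_const (\<beta> $ i) | i. True})"

definition fake_exponent ::
    "int^'n::finite^'d::finite \<Rightarrow> complex^'d \<Rightarrow> real^'n \<Rightarrow> complex^'n \<Rightarrow> bool"
  where "fake_exponent A \<beta> w v \<longleftrightarrow> (\<forall>f \<in> fake_indicial_ideal A \<beta> w. poly_eval f v = 0)"


section \<open>Negative supports\<close>

definition nsupp :: "complex^'n::finite \<Rightarrow> 'n set"
  where "nsupp v = {j. \<exists>k::int. k < 0 \<and> v $ j = of_int k}"

definition nsupp_shift :: "complex^'n::finite \<Rightarrow> int^'n \<Rightarrow> 'n set"
  where "nsupp_shift v\<^sub>0 u = nsupp (v\<^sub>0 + complex_vec u)"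

definition NS :: "int^'n::finite^'d::finite \<Rightarrow> complex^'n \<Rightarrow> 'n set set"
  where "NS A v\<^sub>0 = nsupp_shift v\<^sub>0 ` ker_lattice A"

definition NS_nonneg ::
    "int^'n::finite^'d::finite \<Rightarrow> real^'n \<Rightarrow> complex^'n \<Rightarrow> 'n set set"
  where "NS_nonneg A w v\<^sub>0 =
    {I \<in> NS A v\<^sub>0. \<forall>u \<in> ker_lattice A. nsupp_shift v\<^sub>0 u = I \<longrightarrow> w \<bullet> real_vec u \<ge> 0}"

definition neg_supp_family ::
    "int^'n::finite^'d::finite \<Rightarrow> real^'n \<Rightarrow> complex^'n \<Rightarrow> 'n set set \<Rightarrow> bool"
  where "neg_supp_family A w v\<^sub>0 N \<longleftrightarrow> nsupp_shift v\<^sub>0 0 \<in> N \<and> N \<subseteq> NS_nonneg A w v\<^sub>0"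

definition ordered_family ::
    "int^'n::finite^'d::finite \<Rightarrow> complex^'n \<Rightarrow> 'n set set \<Rightarrow> bool"
  where "ordered_family A v\<^sub>0 N \<longleftrightarrow> (\<forall>I\<in>N. \<forall>J\<in>NS A v\<^sub>0. J \<subseteq> I \<longrightarrow> J \<in> N)"


section \<open>Formal logarithmic series\<close>

text \<open>
  A function \<open>\<phi>\<close> of this type stands for the formal sum \<open>\<Sum>\<^sub>v x\<^sup>v \<phi>(v)(log x)\<close>, with no condition
  on its support. Since \<open>\<partial>\<^sub>j (x\<^sup>v r(log x)) = x\<^sup>v\<^sup>-\<^sup>e ((\<partial>\<^sub>y\<^sub>j + v\<^sub>j) r)(log x)\<close>, where \<open>e\<close> is the
  \<open>j\<close>-th unit vector, iteration gives
  \<open>x\<^sup>a \<partial>\<^sup>b (x\<^sup>v r(log x)) = x\<^sup>v\<^sup>+\<^sup>a\<^sup>-\<^sup>b ((\<Prod>\<^sub>j \<Prod>i<b\<^sub>j. (\<partial>\<^sub>y\<^sub>j + v\<^sub>j - i)) r)(log x)\<close>.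
  Each coefficient of \<open>P \<phi>\<close> is thus determined by finitely many coefficients of \<open>\<phi>\<close>.
\<close>

type_synonym 'n log_series = "complex^'n \<Rightarrow> 'n cpoly"

definition log_diff_symbol :: "complex^'n::finite \<Rightarrow> nat^'n \<Rightarrow> 'n cpoly"
  where "log_diff_symbol v b =
    (\<Prod>j\<in>UNIV. \<Prod>i<b $ j. var j + cpoly_const (v $ j - of_nat i))"

definition weyl_act :: "'n::finite weyl \<Rightarrow> 'n log_series \<Rightarrow> 'n log_series"
  where "weyl_act P \<phi> v = (\<Sum>(a, b)\<in>Poly_Mapping.keys P.
    let v' = v - complex_vec (int_vec a) + complex_vec (int_vec b)
    in cpoly_const (Poly_Mapping.lookup P (a, b)) * (log_diff_symbol v' b \<rhd> \<phi> v'))"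

definition coeff_space ::
    "int^'n::finite^'d::finite \<Rightarrow> complex^'d \<Rightarrow> complex^'n \<Rightarrow> 'n set set \<Rightarrow> 'n cpoly set"
  where "coeff_space A \<beta> v\<^sub>0 N = {\<phi> v\<^sub>0 | \<phi>.
    (\<forall>v. \<phi> v \<noteq> 0 \<longrightarrow> (\<exists>u \<in> ker_lattice A. v = v\<^sub>0 + complex_vec u \<and> nsupp_shift v\<^sub>0 u \<in> N)) \<and>
    (\<forall>P \<in> hypergeometric_ideal A \<beta>. \<forall>v. weyl_act P \<phi> v = 0)}"


section \<open>The ideals attached to a negative support family\<close>

definition K_set :: "'n set set \<Rightarrow> 'n set"
  where "K_set N = \<Inter>N"

definition m_mon :: "complex^'n::finite \<Rightarrow> 'n set set \<Rightarrow> 'n cpoly"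
  where "m_mon v\<^sub>0 N = sqfree_mon (nsupp_shift v\<^sub>0 0 - K_set N)"

definition M_ideal :: "'n::finite set set \<Rightarrow> 'n cpoly set"
  where "M_ideal N = ideal_gen {sqfree_mon (I - K_set N) | I. I \<in> N}"

definition P_ideal ::
    "int^'n::finite^'d::finite \<Rightarrow> complex^'n \<Rightarrow> 'n set set \<Rightarrow> 'n cpoly set"
  where "P_ideal A v\<^sub>0 N =
    ideal_gen {sqfree_mon ((I \<union> J) - K_set N) | I J. I \<in> N \<and> J \<in> NS A v\<^sub>0 - N}"

definition A_ideal :: "int^'n::finite^'d::finite \<Rightarrow> 'n cpoly set"
  where "A_ideal A = ideal_gen {\<Sum>j\<in>UNIV. cpoly_const (of_int (A $ i $ j)) * var j | i. True}"

definition Q_ideal ::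
    "int^'n::finite^'d::finite \<Rightarrow> complex^'n \<Rightarrow> 'n set set \<Rightarrow> 'n cpoly set"
  where "Q_ideal A v\<^sub>0 N = ideal_sum (ideal_prod (A_ideal A) (M_ideal N)) (P_ideal A v\<^sub>0 N)"

end

theory Submission
  imports Defs
begin

text \<open>
  Expand a solution as \<open>\<Sum>\<^sub>u x\<^sup>v\<^sup>+\<^sup>u r\<^sub>u(log x)\<close>. In the toric equations each linear factor
  \<open>\<partial>\<^sub>y\<^sub>j + c\<close> with \<open>c \<noteq> 0\<close> acts invertibly on polynomials. Dividing \<open>r\<^sub>u\<close> by a suitable product of
  such units leaves a polynomial \<open>q\<^sub>I\<close> that depends only on \<open>I = I\<^sub>u\<close>, and the toric equations become
  \<open>\<partial>\<^sup>J\<^sup>-\<^sup>I q\<^sub>I = \<partial>\<^sup>I\<^sup>-\<^sup>J q\<^sub>J\<close>, where \<open>q\<^sub>J = 0\<close> for \<open>J \<notin> N\<close>; the Euler equations become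
  \<open>A\<partial>\<^sub>y q\<^sub>I = 0\<close>. Read on divided-power coefficients, the compatibility says precisely that
  \<open>q\<^sub>I = \<partial>\<^sup>I\<^sup>-\<^sup>K p\<close> for a single polynomial \<open>p\<close>, and the remaining equations say that \<open>p\<close> is killed by
  \<open>\<QQ>\<^sub>N\<close>. Hence the coefficient space is \<open>\<mm>\<^sub>N \<bullet> Sol(\<QQ>\<^sub>N)\<close>. Since \<open>\<QQ>\<^sub>N\<close> is homogeneous,
  duality in each degree gives \<open>Ann(Sol(\<QQ>\<^sub>N)) = \<QQ>\<^sub>N\<close> and
  \<open>\<mm>\<^sub>N \<bullet> Sol(\<QQ>\<^sub>N) = Sol(\<QQ>\<^sub>N : \<mm>\<^sub>N)\<close>.
\<close>

section \<open>Sums over the support of a finitely supported function\<close>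

lemma sum_keys_superset:
  assumes "finite S" "Poly_Mapping.keys f \<subseteq> S" "\<And>k. h k 0 = 0"
  shows "(\<Sum>k\<in>Poly_Mapping.keys f. h k (Poly_Mapping.lookup f k)) =
    (\<Sum>k\<in>S. h k (Poly_Mapping.lookup f k))"
  using assms by (intro sum.mono_neutral_left) (auto simp: in_keys_iff)

text \<open>Cancellation can shrink the support of \<open>f + g\<close>, so all three sums are first
  taken over the union of the two supports. This gives additivity of evaluation, of the differential
  action, of the Weyl product and of its action, all defined as sums over keys.\<close>

lemma sum_keys_add:
  fixes h :: "'k \<Rightarrow> 'v::comm_monoid_add \<Rightarrow> 'm::comm_monoid_add"
  assumes "\<And>k. h k 0 = 0" "\<And>k a b. h k (a + b) = h k a + h k b"
  shows "(\<Sum>k\<in>Poly_Mapping.keys (f + g). h k (Poly_Mapping.lookup (f + g) k)) =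
    (\<Sum>k\<in>Poly_Mapping.keys f. h k (Poly_Mapping.lookup f k)) +
    (\<Sum>k\<in>Poly_Mapping.keys g. h k (Poly_Mapping.lookup g k))"
proof -
  let ?S = "Poly_Mapping.keys f \<union> Poly_Mapping.keys g"
  have *: "finite ?S" "Poly_Mapping.keys (f + g) \<subseteq> ?S"
    by (auto simp: keys_add)
  show ?thesis
    using * sum_keys_superset[of ?S f h] sum_keys_superset[of ?S g h]
      sum_keys_superset[of ?S "f + g" h]
    by (simp add: assms lookup_add sum.distrib)
qed

lemma sum_keys_single:
  assumes "\<And>k. h k 0 = 0"
  shows "(\<Sum>k\<in>Poly_Mapping.keys (Poly_Mapping.single a c).
    h k (Poly_Mapping.lookup (Poly_Mapping.single a c) k)) = h a c"
  using assms by (cases "c = 0") auto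

text \<open>Reduces bilinear identities to pairs of monomials.\<close>

lemma poly_mapping_single_induct [case_names zero single add]:
  assumes "P 0" "\<And>a c. P (Poly_Mapping.single a c)" "\<And>f g. P f \<Longrightarrow> P g \<Longrightarrow> P (f + g)"
  shows "P (f :: 'a \<Rightarrow>\<^sub>0 'b::comm_monoid_add)"
proof (induction f rule: update_induct)
  case const then show ?case using assms(1) .
next
  case (update f a b)
  have "Poly_Mapping.update a b f = f + Poly_Mapping.single a b"
    using update by (intro poly_mapping_eqI)
      (auto simp: lookup_add lookup_update lookup_single in_keys_iff)
  then show ?case using assms update by simp
qed

section \<open>Divided-power coefficients\<close>

text \<open>Coordinates in the basis of divided powers y^a / a!. In these a monomial operator acts
  as a pure shift of the index, with no numerical factor.\<close>

definition dcoef :: "'n::finite cpoly \<Rightarrow> nat^'n \<Rightarrow> complex"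
  where "dcoef p a = Poly_Mapping.lookup p a * (\<Prod>j\<in>UNIV. fact (a $ j))"

lemma dcoef_eq_0_iff: "dcoef p a = 0 \<longleftrightarrow> Poly_Mapping.lookup p a = 0"
  by (simp add: dcoef_def)

lemma dcoef_eqI: "(\<And>a. dcoef p a = dcoef q a) \<Longrightarrow> p = q"
  by (intro poly_mapping_eqI) (simp add: dcoef_def)

lemma dcoef_0 [simp]: "dcoef 0 a = 0"
  and dcoef_add: "dcoef (p + q) a = dcoef p a + dcoef q a"
  by (simp_all add: dcoef_def lookup_add algebra_simps)

lemma dcoef_exists:
  assumes "finite {a. c a \<noteq> 0}"
  shows "\<exists>p. \<forall>a. dcoef p a = c a"
proof -
  have "finite {a. c a / (\<Prod>j\<in>UNIV. fact (a $ j)) \<noteq> 0}"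
    using assms by simp
  then have "dcoef (Abs_poly_mapping (\<lambda>a. c a / (\<Prod>j\<in>UNIV. fact (a $ j)))) a = c a" for a
    by (simp add: dcoef_def Abs_poly_mapping_inverse)
  then show ?thesis by blast
qed

lemma prod_falling_fact:
  "(\<Prod>i<b. of_nat (a + b) - of_nat i) * fact a = (fact (a + b) :: 'a::{comm_ring_1,semiring_char_0})"
proof (induction b)
  case (Suc b)
  have "(\<Prod>i<Suc b. of_nat (a + Suc b) - of_nat i) =
      (of_nat (a + Suc b) * (\<Prod>i<b. of_nat (a + b) - of_nat i) :: 'a)"
    by (subst prod.lessThan_Suc_shift) simp
  then show ?case using Suc by (simp add: mult.assoc del: of_nat_add of_nat_Suc)
qed simp

lemma prod_falling_eq_0:
  "a < b \<Longrightarrow> (\<Prod>i<b. of_nat a - of_nat i) = (0 :: 'a::{comm_ring_1,semiring_char_0})"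
  by (rule prod_zero) auto

text \<open>Differentiation produces the falling factorial (a + b)! / a!, and the factor a! in
  \<open>dcoef\<close> completes it to (a + b)!.\<close>

lemma dcoef_diff_act:
  "dcoef (f \<rhd> p) a = (\<Sum>b\<in>Poly_Mapping.keys f. Poly_Mapping.lookup f b * dcoef p (a + b))"
proof -
  let ?F = "\<lambda>a b. \<Prod>j\<in>UNIV. \<Prod>i<b $ j. (of_nat (a $ j) - of_nat i :: complex)"
  have "(\<Sum>a'\<in>Poly_Mapping.keys p. Poly_Mapping.lookup (Poly_Mapping.single (a' - b)
      (Poly_Mapping.lookup f b * Poly_Mapping.lookup p a' * ?F a' b)) a) *
      (\<Prod>j\<in>UNIV. fact (a $ j)) = Poly_Mapping.lookup f b * dcoef p (a + b)" for b
  proof -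
    \<comment> \<open>Truncated subtraction can give \<open>a' - b = a\<close> although
      \<open>b \<le> a'\<close> fails. The falling factorial then vanishes, so the index
      \<open>a + b\<close> alone contributes.\<close>
    have *: "(Poly_Mapping.lookup f b * Poly_Mapping.lookup p a' * ?F a' b when a' - b = a) =
        (if a' = a + b then Poly_Mapping.lookup f b * Poly_Mapping.lookup p a' * ?F a' b else 0)" for a'
    proof (cases "\<exists>j. a' $ j < b $ j")
      case True
      then obtain j where j: "a' $ j < b $ j" by blast
      then have "(\<Prod>i<b $ j. (of_nat (a' $ j) - of_nat i :: complex)) = 0"
        by (rule prod_falling_eq_0)
      then have "?F a' b = 0" by (intro prod_zero) auto
      then show ?thesis by (simp only: mult_zero_right) (simp add: when_def)
    next
      case False
      then have "a' - b = a \<longleftrightarrow> a' = a + b"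
        by (simp add: vec_eq_iff not_less) (metis add_diff_cancel_right' le_add_diff_inverse2)
      then show ?thesis by (simp add: when_def)
    qed
    have F: "?F (a + b) b * (\<Prod>j\<in>UNIV. fact (a $ j)) = (\<Prod>j\<in>UNIV. fact ((a + b) $ j))"
      by (simp add: prod.distrib[symmetric] prod_falling_fact[symmetric])
    have "(\<Sum>a'\<in>Poly_Mapping.keys p. Poly_Mapping.lookup (Poly_Mapping.single (a' - b)
        (Poly_Mapping.lookup f b * Poly_Mapping.lookup p a' * ?F a' b)) a) =
        Poly_Mapping.lookup f b * Poly_Mapping.lookup p (a + b) * ?F (a + b) b"
      by (simp only: lookup_single * sum.delta finite_keys) (simp add: in_keys_iff)
    with F show ?thesis
      by (simp only: dcoef_def mult.assoc)
  qed
  then show ?thesis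
    by (simp add: dcoef_def diff_act_def lookup_sum sum_distrib_right)
qed

lemma dcoef_single_act [simp]: "dcoef (Poly_Mapping.single b c \<rhd> p) a = c * dcoef p (a + b)"
  by (cases "c = 0") (simp_all add: dcoef_diff_act)

lemma diff_act_add_left: "(f + g) \<rhd> p = f \<rhd> p + g \<rhd> p"
proof (rule dcoef_eqI)
  show "dcoef ((f + g) \<rhd> p) a = dcoef (f \<rhd> p + g \<rhd> p) a" for a
    using sum_keys_add[of "\<lambda>b c. c * dcoef p (a + b)" f g]
    by (simp add: dcoef_add dcoef_diff_act algebra_simps)
qed

lemma diff_act_add_right: "f \<rhd> (p + q) = f \<rhd> p + f \<rhd> q"
  by (rule dcoef_eqI) (simp add: dcoef_add dcoef_diff_act algebra_simps sum.distrib)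

lemma diff_act_0_left [simp]: "0 \<rhd> p = 0"
  by (simp add: diff_act_def)

lemma diff_act_0_right [simp]: "f \<rhd> 0 = 0"
  by (simp add: diff_act_def)

lemma diff_act_minus_left: "(f - g) \<rhd> p = f \<rhd> p - g \<rhd> p"
  using diff_act_add_left[of "f - g" g p] by (simp add: algebra_simps)

lemma diff_act_sum_left: "(\<Sum>i\<in>S. f i) \<rhd> p = (\<Sum>i\<in>S. f i \<rhd> p)"
  by (induction S rule: infinite_finite_induct) (simp_all add: diff_act_add_left)

text \<open>Shifts of divided-power coefficients compose additively, so polynomials form a module
  over the ring of operators.\<close>

lemma diff_act_mult: "(f * g) \<rhd> p = f \<rhd> (g \<rhd> p)"
proof (induction f rule: poly_mapping_single_induct)
  case (single b c)
  show ?case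
  proof (induction g rule: poly_mapping_single_induct)
    case (single b' c')
    show ?case
      by (rule dcoef_eqI) (simp add: mult_single algebra_simps)
  qed (simp_all add: distrib_left diff_act_add_left diff_act_add_right)
qed (simp_all add: distrib_right diff_act_add_left)

lemma diff_act_commute: "f \<rhd> (g \<rhd> p) = g \<rhd> (f \<rhd> p)"
  by (simp only: diff_act_mult[symmetric] mult.commute)

lemma lookup_const_mult:
  "Poly_Mapping.lookup (cpoly_const c * f) a = c * Poly_Mapping.lookup f a"
proof (induction f rule: poly_mapping_single_induct)
  case (single b d)
  then show ?case by (simp add: cpoly_const_def mult_single lookup_single when_def)
qed (simp_all add: distrib_left lookup_add)

lemma cpoly_const_act: "cpoly_const c \<rhd> p = cpoly_const c * p"
proof (rule dcoef_eqI)
  show "dcoef (cpoly_const c \<rhd> p) a = dcoef (cpoly_const c * p) a" for a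
    unfolding dcoef_def[of "cpoly_const c * p"] lookup_const_mult
    by (simp add: cpoly_const_def) (simp add: dcoef_def)
qed

lemma cpoly_const_0 [simp]: "cpoly_const 0 = 0"
  and cpoly_const_1 [simp]: "cpoly_const 1 = 1"
  and cpoly_const_add: "cpoly_const (c + d) = cpoly_const c + cpoly_const d"
  and cpoly_const_minus: "cpoly_const (c - d) = cpoly_const c - cpoly_const d"
  and cpoly_const_mult: "cpoly_const (c * d) = cpoly_const c * cpoly_const d"
  by (simp_all add: cpoly_const_def single_add single_diff mult_single)

lemma cpoly_const_of_nat: "cpoly_const (of_nat n) = of_nat n"
  by (induction n) (simp_all add: cpoly_const_add)

lemma diff_act_1 [simp]: "1 \<rhd> p = p"
  using cpoly_const_act[of 1 p] by simp

lemma diff_act_const_mult: "f \<rhd> (cpoly_const c * p) = cpoly_const c * (f \<rhd> p)"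
  by (metis cpoly_const_act diff_act_mult mult.commute)

lemma poly_eval_0: "poly_eval f 0 = dcoef f 0"
proof -
  have "(\<Prod>j\<in>UNIV. ((0 :: complex^'n) $ j) ^ (u $ j)) = (if u = 0 then 1 else 0)" for u :: "nat^'n"
    by (auto simp: vec_eq_iff prod_zero_iff)
  then have "poly_eval f 0 =
      (\<Sum>u\<in>Poly_Mapping.keys f. if u = 0 then Poly_Mapping.lookup f u else 0)"
    unfolding poly_eval_def by (intro sum.cong) (auto simp: vec_eq_iff)
  then show ?thesis
    by (simp add: dcoef_def in_keys_iff)
qed

text \<open>This pairing of operators with polynomials makes monomials and divided powers dual to
  each other; the duality arguments below run through it.\<close>

lemma poly_eval_diff_act:
  "poly_eval (f \<rhd> p) 0 = (\<Sum>b\<in>Poly_Mapping.keys f. Poly_Mapping.lookup f b * dcoef p b)"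
  by (simp add: poly_eval_0 dcoef_diff_act)

lemma poly_eval_add: "poly_eval (f + g) v = poly_eval f v + poly_eval g v"
  unfolding poly_eval_def by (rule sum_keys_add) (simp_all add: algebra_simps)

lemma poly_eval_minus: "poly_eval (f - g) v = poly_eval f v - poly_eval g v"
  using poly_eval_add[of "f - g" g v] by simp

lemma poly_eval_single:
  "poly_eval (Poly_Mapping.single a c) v = c * (\<Prod>j\<in>UNIV. (v $ j) ^ (a $ j))"
  unfolding poly_eval_def by (rule sum_keys_single) simp

lemma poly_eval_sum: "poly_eval (\<Sum>i\<in>S. f i) v = (\<Sum>i\<in>S. poly_eval (f i) v)"
  by (induction S rule: infinite_finite_induct) (simp_all add: poly_eval_add, simp_all add: poly_eval_def)

lemma cpoly_const_mult_var:
  "cpoly_const c * var j = Poly_Mapping.single (axis j 1) c"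
  by (simp add: cpoly_const_def var_def mon_def mult_single)

lemma poly_eval_const_mult_var: "poly_eval (cpoly_const c * var j) v = c * v $ j"
proof -
  have "(\<Prod>i\<in>UNIV. (v $ i) ^ (axis j 1 $ i)) = (\<Prod>i\<in>UNIV. if i = j then v $ j else 1)"
    by (rule prod.cong) (auto simp: axis_def)
  then show ?thesis by (simp add: cpoly_const_mult_var poly_eval_single)
qed

lemma poly_eval_const: "poly_eval (cpoly_const c) v = c"
  by (simp add: cpoly_const_def poly_eval_single)

lemma pairing_ext:
  assumes "\<And>f. poly_eval (f \<rhd> p) 0 = poly_eval (f \<rhd> q) 0"
  shows "p = q"
proof (rule dcoef_eqI)
  show "dcoef p a = dcoef q a" for a
    using assms[of "mon a"] by (simp add: poly_eval_diff_act mon_def)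
qed

section \<open>The action of the Weyl algebra on logarithmic series\<close>

text \<open>Stated over any commutative ring because the argument will be an operator
  \<open>var j + cpoly_const c\<close>.\<close>

definition falling :: "'a::comm_ring_1 \<Rightarrow> nat \<Rightarrow> 'a"
  where "falling z n = (\<Prod>i<n. z - of_nat i)"

lemma falling_0 [simp]: "falling z 0 = 1"
  and falling_Suc: "falling z (Suc n) = falling z n * (z - of_nat n)"
  by (simp_all add: falling_def)

lemma falling_add: "falling z (m + n) = falling z m * falling (z - of_nat m) n"
  by (induction n) (simp_all add: falling_Suc algebra_simps)

lemma falling_of_nat: "falling (of_nat c) k = of_nat ((c choose k) * fact k)"
proof (induction k)
  case (Suc k)
  have "(c choose k) * fact k * c = (c choose k) * fact k * k + (c choose Suc k) * fact (Suc k)"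
  proof (cases "k \<le> c")
    case True
    then have "c = k + (c - k)" by simp
    moreover have "(c - k) * (c choose k) = Suc k * (c choose Suc k)"
      by (simp only: binomial_absorb_comp binomial_absorption)
    then have "(c choose k) * fact k * (c - k) = (c choose Suc k) * fact (Suc k)"
      by (simp only: fact_Suc of_nat_id mult_ac)
    ultimately show ?thesis by (metis distrib_left)
  qed (simp add: binomial_eq_0)
  then have "of_nat ((c choose k) * fact k * c) =
      (of_nat ((c choose k) * fact k * k + (c choose Suc k) * fact (Suc k)) :: 'a)"
    by (rule arg_cong)
  then show ?case
    using Suc by (simp add: falling_Suc right_diff_distrib del: of_nat_Suc fact_Suc)
qed simp

text \<open>Chu-Vandermonde by induction on b. The new factor y + z - b is split as (y - k) + (z -
  (b - k)), each summand extends one of the falling factorials, and Pascal's rule recombines the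
  terms.\<close>

lemma falling_vandermonde:
  "(\<Sum>k\<le>b. of_nat (b choose k) * falling y k * falling z (b - k)) = falling (y + z) b"
proof (induction b)
  case (Suc b)
  let ?f = "\<lambda>k. falling y k" and ?g = "\<lambda>k. falling z k"
  have "falling (y + z) (Suc b) =
      (\<Sum>k\<le>b. of_nat (b choose k) * ?f k * ?g (b - k) * (y + z - of_nat b))"
    unfolding falling_Suc Suc[symmetric] by (simp add: sum_distrib_right)
  also have "\<dots> = (\<Sum>k\<le>b. of_nat (b choose k) * ?f (Suc k) * ?g (b - k) +
      of_nat (b choose k) * ?f k * ?g (Suc b - k))"
  proof (rule sum.cong)
    fix k assume "k \<in> {..b}"
    then have "y + z - of_nat b = (y - of_nat k) + (z - of_nat (b - k))" "Suc b - k = Suc (b - k)"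
      by (auto simp: of_nat_diff)
    then show "of_nat (b choose k) * ?f k * ?g (b - k) * (y + z - of_nat b) =
      of_nat (b choose k) * ?f (Suc k) * ?g (b - k) + of_nat (b choose k) * ?f k * ?g (Suc b - k)"
      by (simp only: falling_Suc) (simp add: algebra_simps)
  qed simp
  also have "\<dots> = (\<Sum>k\<le>b. of_nat (b choose k) * ?f (Suc k) * ?g (b - k)) +
      (\<Sum>k\<le>Suc b. of_nat (b choose k) * ?f k * ?g (Suc b - k))"
    by (simp add: sum.distrib binomial_eq_0)
  also have "(\<Sum>k\<le>Suc b. of_nat (b choose k) * ?f k * ?g (Suc b - k)) =
      ?g (Suc b) + (\<Sum>k\<le>b. of_nat (b choose Suc k) * ?f (Suc k) * ?g (b - k))"
    by (subst sum.atMost_Suc_shift) simp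
  also have "(\<Sum>k\<le>b. of_nat (b choose k) * ?f (Suc k) * ?g (b - k)) +
      (?g (Suc b) + (\<Sum>k\<le>b. of_nat (b choose Suc k) * ?f (Suc k) * ?g (b - k))) =
      ?g (Suc b) + (\<Sum>k\<le>b. of_nat (Suc b choose Suc k) * ?f (Suc k) * ?g (b - k))"
    by (simp add: sum.distrib[symmetric] algebra_simps)
  also have "\<dots> = (\<Sum>k\<le>Suc b. of_nat (Suc b choose k) * ?f k * ?g (Suc b - k))"
    by (subst sum.atMost_Suc_shift) simp
  finally show ?case by simp
qed simp

text \<open>Both sides are the scalar by which \<partial>^b t^c \<partial>^d acts on the power t^x:
  normally ordered on the left, factor by factor on the right. After splitting off
  \<open>falling x d\<close> it is Vandermonde's identity for c and x - d.\<close>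

lemma falling_leibniz:
  "(\<Sum>k\<le>min b c. of_nat ((b choose k) * (c choose k) * fact k) * falling x (b + d - k)) =
    falling x d * falling (x - of_nat d + of_nat c) b"
proof -
  have "(\<Sum>k\<le>min b c. of_nat ((b choose k) * (c choose k) * fact k) * falling x (b + d - k)) =
      (\<Sum>k\<le>b. of_nat ((b choose k) * (c choose k) * fact k) * falling x (b + d - k))"
  proof (rule sum.mono_neutral_left)
    show "\<forall>k\<in>{..b} - {..min b c}.
        of_nat ((b choose k) * (c choose k) * fact k) * falling x (b + d - k) = 0"
    proof
      fix k assume "k \<in> {..b} - {..min b c}"
      then have "c choose k = 0" by (auto intro: binomial_eq_0)
      then show "of_nat ((b choose k) * (c choose k) * fact k) * falling x (b + d - k) = 0"
        by (simp add: binomial_eq_0)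
    qed
  qed auto
  also have "\<dots> = (\<Sum>k\<le>b. falling x d *
      (of_nat (b choose k) * falling (of_nat c) k * falling (x - of_nat d) (b - k)))"
  proof (rule sum.cong)
    fix k assume "k \<in> {..b}"
    then have "falling x (b + d - k) = falling x d * falling (x - of_nat d) (b - k)"
      using falling_add[of x d "b - k"] by (simp add: add.commute)
    then show "of_nat ((b choose k) * (c choose k) * fact k) * falling x (b + d - k) =
      falling x d * (of_nat (b choose k) * falling (of_nat c) k * falling (x - of_nat d) (b - k))"
      unfolding falling_of_nat by (simp only: of_nat_mult mult_ac)
  qed simp
  also have "\<dots> = falling x d * falling (of_nat c + (x - of_nat d)) b"
    by (simp only: sum_distrib_left[symmetric] falling_vandermonde)
  finally show ?thesis by (simp add: add.commute)
qed

lemma sum_prod_vec: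
  fixes g :: "'n::finite \<Rightarrow> 'a \<Rightarrow> 'b::comm_semiring_1"
  assumes "\<And>j. finite (F j)"
  shows "(\<Sum>k | \<forall>j. k $ j \<in> F j. \<Prod>j\<in>UNIV. g j (k $ j)) = (\<Prod>j\<in>UNIV. \<Sum>i\<in>F j. g j i)"
proof -
  have "(\<Sum>k | \<forall>j. k $ j \<in> F j. \<Prod>j\<in>UNIV. g j (k $ j)) =
      (\<Sum>h\<in>Pi\<^sub>E UNIV F. \<Prod>j\<in>UNIV. g j (h j))"
    by (rule sum.reindex_bij_witness[of _ vec_lambda "($)"]) auto
  also have "\<dots> = (\<Prod>j\<in>UNIV. \<Sum>i\<in>F j. g j i)"
    using assms by (intro prod_sum_PiE[symmetric]) auto
  finally show ?thesis .
qed

lemma log_diff_symbol_falling: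
  "log_diff_symbol v b = (\<Prod>j\<in>UNIV. falling (var j + cpoly_const (v $ j)) (b $ j))"
  unfolding log_diff_symbol_def falling_def
  by (simp add: cpoly_const_minus cpoly_const_of_nat add_diff_eq)

lemma complex_vec_add: "complex_vec (u + v) = complex_vec u + complex_vec v"
  and complex_vec_minus: "complex_vec (u - v) = complex_vec u - complex_vec v"
  and complex_vec_0 [simp]: "complex_vec 0 = 0"
  and int_vec_0 [simp]: "int_vec 0 = 0"
  by (simp_all add: complex_vec_def int_vec_def vec_eq_iff)

text \<open>The coordinates separate: the sum over vectors k of products is a product of
  one-variable sums, each given by \<open>falling_leibniz\<close>.\<close>

lemma log_diff_symbol_leibniz:
  "(\<Sum>k | k \<le> b \<and> k \<le> c.
      of_nat (\<Prod>j\<in>UNIV. (b $ j choose k $ j) * (c $ j choose k $ j) * fact (k $ j)) *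
        log_diff_symbol v (b + d - k)) =
    log_diff_symbol (v - complex_vec (int_vec d) + complex_vec (int_vec c)) b * log_diff_symbol v d"
proof -
  let ?x = "\<lambda>j. var j + cpoly_const (v $ j)"
  have "{k. k \<le> b \<and> k \<le> c} = {k. \<forall>j. k $ j \<in> {..min (b $ j) (c $ j)}}"
    by (auto simp: less_eq_vec_def)
  then have "(\<Sum>k | k \<le> b \<and> k \<le> c.
      of_nat (\<Prod>j\<in>UNIV. (b $ j choose k $ j) * (c $ j choose k $ j) * fact (k $ j)) *
        log_diff_symbol v (b + d - k)) =
      (\<Sum>k | \<forall>j. k $ j \<in> {..min (b $ j) (c $ j)}. \<Prod>j\<in>UNIV.
        of_nat ((b $ j choose k $ j) * (c $ j choose k $ j) * fact (k $ j)) *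
          falling (?x j) (b $ j + d $ j - k $ j))"
    by (simp only: log_diff_symbol_falling of_nat_prod prod.distrib[symmetric] vector_add_component
      vector_minus_component)
  also have "\<dots> = (\<Prod>j\<in>UNIV. falling (?x j) (d $ j) *
      falling (?x j - of_nat (d $ j) + of_nat (c $ j)) (b $ j))"
    by (subst sum_prod_vec[where g = "\<lambda>j i. of_nat ((b $ j choose i) * (c $ j choose i) * fact i) *
          falling (?x j) (b $ j + d $ j - i)"]) (simp_all only: finite_atMost falling_leibniz)
  also have "\<dots> = log_diff_symbol (v - complex_vec (int_vec d) + complex_vec (int_vec c)) b *
      log_diff_symbol v d"
  proof -
    have "?x j - of_nat (d $ j) + of_nat (c $ j) =
        var j + cpoly_const ((v - complex_vec (int_vec d) + complex_vec (int_vec c)) $ j)" for j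
      by (simp add: complex_vec_def int_vec_def cpoly_const_add cpoly_const_minus cpoly_const_of_nat)
    then show ?thesis
      by (simp only: log_diff_symbol_falling prod.distrib mult.commute)
  qed
  finally show ?thesis .
qed

section \<open>Logarithmic series as a left module over the Weyl algebra\<close>

definition weyl_term :: "nat^'n::finite \<Rightarrow> nat^'n \<Rightarrow> 'n log_series \<Rightarrow> 'n log_series"
  where "weyl_term a b \<phi> v =
    (let v' = v - complex_vec (int_vec a) + complex_vec (int_vec b) in log_diff_symbol v' b \<rhd> \<phi> v')"

lemma weyl_act_terms:
  "weyl_act P \<phi> v = (\<Sum>k\<in>Poly_Mapping.keys P.
    cpoly_const (Poly_Mapping.lookup P k) * weyl_term (fst k) (snd k) \<phi> v)"
  by (simp add: weyl_act_def weyl_term_def Let_def split_def)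

lemma weyl_act_0 [simp]: "weyl_act 0 \<phi> v = 0"
  by (simp add: weyl_act_def)

lemma weyl_act_add: "weyl_act (P + Q) \<phi> v = weyl_act P \<phi> v + weyl_act Q \<phi> v"
  unfolding weyl_act_terms by (rule sum_keys_add) (simp_all add: cpoly_const_add distrib_right)

lemma weyl_act_minus: "weyl_act (P - Q) \<phi> v = weyl_act P \<phi> v - weyl_act Q \<phi> v"
  using weyl_act_add[of "P - Q" Q \<phi> v] by simp

lemma weyl_act_sum: "weyl_act (\<Sum>i\<in>S. P i) \<phi> v = (\<Sum>i\<in>S. weyl_act (P i) \<phi> v)"
  by (induction S rule: infinite_finite_induct) (simp_all add: weyl_act_add)

lemma weyl_act_single:
  "weyl_act (Poly_Mapping.single (a, b) c) \<phi> v = cpoly_const c * weyl_term a b \<phi> v"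
  unfolding weyl_act_terms by (subst sum_keys_single) simp_all

lemma weyl_act_add_series:
  "weyl_act P (\<lambda>v. \<phi> v + \<psi> v) v = weyl_act P \<phi> v + weyl_act P \<psi> v"
  by (simp add: weyl_act_terms weyl_term_def Let_def diff_act_add_right distrib_left sum.distrib)

lemma weyl_act_zero_series: "(\<And>v. \<phi> v = 0) \<Longrightarrow> weyl_act P \<phi> v = 0"
  by (simp add: weyl_act_terms weyl_term_def Let_def)

lemma weyl_mult_0 [simp]: "0 \<star> Q = 0" "P \<star> 0 = 0"
  by (simp_all add: weyl_mult_def)

lemma weyl_mult_add_left: "(P + P') \<star> Q = P \<star> Q + P' \<star> Q"
  unfolding weyl_mult_def split_def prod.collapse
  by (rule sum_keys_add) (simp_all add: distrib_right single_add sum.distrib)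

lemma weyl_mult_add_right: "P \<star> (Q + Q') = P \<star> Q + P \<star> Q'"
  unfolding weyl_mult_def split_def prod.collapse sum.distrib[symmetric]
  by (intro sum.cong refl sum_keys_add)
    (simp_all add: distrib_left distrib_right single_add sum.distrib)

lemma weyl_mult_single:
  "Poly_Mapping.single (a, b) p \<star> Poly_Mapping.single (c, d) q =
    (\<Sum>k | k \<le> b \<and> k \<le> c. Poly_Mapping.single (a + c - k, b + d - k)
      (p * q * of_nat (\<Prod>j\<in>UNIV. (b $ j choose k $ j) * (c $ j choose k $ j) * fact (k $ j))))"
  by (cases "p = 0"; cases "q = 0") (simp_all add: weyl_mult_def)

text \<open>On monomials this is the Leibniz identity for \<open>log_diff_symbol\<close>. The
  resulting module structure allows annihilation by a left ideal to be tested on generators.\<close>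

lemma weyl_act_mult: "weyl_act (P \<star> Q) \<phi> v = weyl_act P (weyl_act Q \<phi>) v"
proof (induction P arbitrary: v rule: poly_mapping_single_induct)
  case (single ab p)
  obtain a b where ab: "ab = (a, b)" by fastforce
  show ?case
  proof (induction Q arbitrary: v rule: poly_mapping_single_induct)
    case (single cd q)
    obtain c d where cd: "cd = (c, d)" by fastforce
    define v1 where "v1 = v - complex_vec (int_vec a) + complex_vec (int_vec b)"
    define v2 where "v2 = v1 - complex_vec (int_vec c) + complex_vec (int_vec d)"
    let ?n = "\<lambda>k. \<Prod>j\<in>UNIV. (b $ j choose k $ j) * (c $ j choose k $ j) * fact (k $ j)"
    have "weyl_act (Poly_Mapping.single (a + c - k, b + d - k) (p * q * of_nat (?n k))) \<phi> v =
        cpoly_const (p * q) * ((of_nat (?n k) * log_diff_symbol v2 (b + d - k)) \<rhd> \<phi> v2)"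
      if "k \<in> {k. k \<le> b \<and> k \<le> c}" for k
    proof -
      \<comment> \<open>The shift k cancels, so all terms of the product read the same coefficient
        of the series, the one at \<open>v2\<close>.\<close>
      have "v - complex_vec (int_vec (a + c - k)) + complex_vec (int_vec (b + d - k)) = v2"
        using that unfolding v1_def v2_def
        by (simp add: vec_eq_iff complex_vec_def int_vec_def less_eq_vec_def of_nat_diff
          trans_le_add1 trans_le_add2)
      then show ?thesis
        by (simp only: weyl_act_single weyl_term_def Let_def cpoly_const_mult cpoly_const_of_nat[symmetric]
          diff_act_mult cpoly_const_act mult.assoc)
    qed
    then have "weyl_act (Poly_Mapping.single ab p \<star> Poly_Mapping.single cd q) \<phi> v =
        (\<Sum>k | k \<le> b \<and> k \<le> c.
          cpoly_const (p * q) * ((of_nat (?n k) * log_diff_symbol v2 (b + d - k)) \<rhd> \<phi> v2))"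
      unfolding ab cd weyl_mult_single weyl_act_sum by (rule sum.cong[OF refl])
    also have "\<dots> = cpoly_const (p * q) * ((log_diff_symbol v1 b * log_diff_symbol v2 d) \<rhd> \<phi> v2)"
    proof -
      have "v2 - complex_vec (int_vec d) + complex_vec (int_vec c) = v1"
        by (simp add: v2_def)
      then show ?thesis
        by (simp only: sum_distrib_left[symmetric] diff_act_sum_left[symmetric] log_diff_symbol_leibniz)
    qed
    also have "\<dots> = weyl_act (Poly_Mapping.single ab p) (weyl_act (Poly_Mapping.single cd q) \<phi>) v"
      unfolding ab cd weyl_act_single weyl_term_def Let_def v1_def[symmetric] v2_def[symmetric]
      by (simp only: diff_act_const_mult diff_act_mult cpoly_const_mult mult.assoc)
    finally show ?case .
  next
    case (add Q Q')
    have "weyl_act (Q + Q') \<phi> = (\<lambda>v. weyl_act Q \<phi> v + weyl_act Q' \<phi> v)"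
      by (rule ext) (rule weyl_act_add)
    with add show ?case
      by (simp only: weyl_mult_add_right weyl_act_add weyl_act_add_series)
  qed (simp add: weyl_act_zero_series)
qed (simp_all add: weyl_mult_add_left weyl_act_add)

lemma weyl_act_left_ideal_gen:
  "(\<forall>P\<in>left_ideal_gen S. \<forall>v. weyl_act P \<phi> v = 0) \<longleftrightarrow> (\<forall>P\<in>S. \<forall>v. weyl_act P \<phi> v = 0)"
proof
  assume *: "\<forall>P\<in>S. \<forall>v. weyl_act P \<phi> v = 0"
  have "\<forall>v. weyl_act P \<phi> v = 0" if "P \<in> left_ideal_gen S" for P
    using that
  proof induction
    case (mult Q P)
    then show ?case by (simp add: weyl_act_mult weyl_act_zero_series)
  qed (use * in \<open>simp_all add: weyl_act_add\<close>)
  then show "\<forall>P\<in>left_ideal_gen S. \<forall>v. weyl_act P \<phi> v = 0" by blast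
qed (blast intro: left_ideal_gen.gen)

lemma weyl_of_diff_add: "weyl_of_diff (f + g) = weyl_of_diff f + weyl_of_diff g"
  unfolding weyl_of_diff_def by (rule sum_keys_add) (simp_all add: single_add)

lemma weyl_of_diff_single:
  "weyl_of_diff (Poly_Mapping.single b c) = Poly_Mapping.single (0, b) c"
  unfolding weyl_of_diff_def by (rule sum_keys_single) simp

lemma weyl_of_diff_0 [simp]: "weyl_of_diff 0 = 0"
  by (simp add: weyl_of_diff_def)

lemma weyl_of_diff_minus: "weyl_of_diff (f - g) = weyl_of_diff f - weyl_of_diff g"
  using weyl_of_diff_add[of "f - g" g] by (simp add: algebra_simps)

lemma weyl_of_diff_mult: "weyl_of_diff (f * g) = weyl_of_diff f \<star> weyl_of_diff g"
proof (induction f rule: poly_mapping_single_induct)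
  case (single b c)
  show ?case
  proof (induction g rule: poly_mapping_single_induct)
    case (single b' c')
    \<comment> \<open>The right factor contains no x, so normal ordering produces the term k = 0
      alone.\<close>
    have "{k. k \<le> b \<and> k \<le> (0 :: nat^'a)} = {0}"
      by (auto simp: less_eq_vec_def vec_eq_iff)
    then show ?case
      by (simp add: mult_single weyl_of_diff_single weyl_mult_single)
  qed (simp_all add: distrib_left weyl_of_diff_add weyl_mult_add_right)
qed (simp_all add: distrib_right weyl_of_diff_add weyl_mult_add_left)

text \<open>The derivative reads the coefficient at u + e_j, where the scalar is u_j + 1, and x_j
  shifts back. The exponent is preserved and the scalar becomes v_j.\<close>

lemma weyl_act_theta:
  "weyl_act (weyl_theta j) \<phi> v = (var j + cpoly_const (v $ j)) \<rhd> \<phi> v"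
proof -
  have d: "weyl_act (weyl_d j) \<phi> u =
      (var j + cpoly_const (u $ j + 1)) \<rhd> \<phi> (u + complex_vec (int_vec (axis j 1)))" for u
  proof -
    have "log_diff_symbol (u + complex_vec (int_vec (axis j 1))) (axis j 1) =
        (\<Prod>i\<in>UNIV. if i = j then var j + cpoly_const (u $ j + 1) else 1)"
      unfolding log_diff_symbol_def
      by (rule prod.cong) (auto simp: axis_def complex_vec_def int_vec_def)
    then show ?thesis
      by (simp add: weyl_d_def weyl_act_single weyl_term_def)
  qed
  have x: "weyl_act (weyl_x j) \<psi> u = \<psi> (u - complex_vec (int_vec (axis j 1)))" for \<psi> u
    by (simp add: weyl_x_def weyl_act_single weyl_term_def log_diff_symbol_def)
  show ?thesis
    unfolding weyl_theta_def weyl_act_mult x d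
    by (simp add: complex_vec_def int_vec_def axis_def)
qed

lemma weyl_act_const: "weyl_act (weyl_const c) \<phi> v = cpoly_const c * \<phi> v"
  by (simp add: weyl_const_def weyl_act_single weyl_term_def log_diff_symbol_def)

lemma cpoly_const_sum: "cpoly_const (\<Sum>j\<in>S. f j) = (\<Sum>j\<in>S. cpoly_const (f j))"
  by (induction S rule: infinite_finite_induct) (simp_all add: cpoly_const_add)

text \<open>Separates the constant-coefficient part A \<partial>_y from the scalar (A v -
  \<beta>)_i, which vanishes at all exponents that occur in the solutions.\<close>

lemma weyl_act_euler_op:
  "weyl_act (euler_op A \<beta> i) \<phi> v =
    (\<Sum>j\<in>UNIV. cpoly_const (of_int (A $ i $ j)) * var j) \<rhd> \<phi> v +
    cpoly_const ((\<Sum>j\<in>UNIV. of_int (A $ i $ j) * v $ j) - \<beta> $ i) * \<phi> v"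
  unfolding euler_op_def weyl_act_minus weyl_act_sum weyl_act_mult weyl_act_const weyl_act_theta
  by (simp add: diff_act_add_left diff_act_sum_left diff_act_mult cpoly_const_act cpoly_const_minus
    cpoly_const_sum cpoly_const_mult distrib_left sum.distrib left_diff_distrib sum_distrib_right
    mult.assoc)

section \<open>Ideals and truncation\<close>

text \<open>Submodules of the ring over itself are its ideals. The interpretation after it supplies
  complex-linear functionals on the polynomial ring.\<close>

interpretation cpoly_ideal: module "(*) :: 'n::finite cpoly \<Rightarrow> 'n cpoly \<Rightarrow> 'n cpoly"
  by unfold_locales (simp_all add: distrib_left distrib_right mult.assoc)

interpretation cpoly_pair: vector_space_pair "\<lambda>c (f :: 'n::finite cpoly). cpoly_const c * f"
    "(*) :: complex \<Rightarrow> complex \<Rightarrow> complex"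
  by unfold_locales
    (simp_all only: distrib_left distrib_right mult.assoc cpoly_const_add cpoly_const_mult
      cpoly_const_1 mult_1_left)

lemma ideal_genE:
  assumes "f \<in> ideal_gen S" "P 0" "\<And>c g f. g \<in> S \<Longrightarrow> P f \<Longrightarrow> P (c * g + f)"
  shows "P f"
  using assms(1) unfolding ideal_gen_def
  by (rule cpoly_ideal.span_induct_alt) (fact assms)+

lemma ideal_gen_base: "f \<in> S \<Longrightarrow> f \<in> ideal_gen S"
  and ideal_gen_0: "0 \<in> ideal_gen S"
  and ideal_gen_add: "f \<in> ideal_gen S \<Longrightarrow> g \<in> ideal_gen S \<Longrightarrow> f + g \<in> ideal_gen S"
  and ideal_gen_mult: "f \<in> ideal_gen S \<Longrightarrow> g * f \<in> ideal_gen S"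
  and subspace_ideal_gen: "cpoly_ideal.subspace (ideal_gen S)"
  by (simp_all add: ideal_gen_def cpoly_ideal.span_base cpoly_ideal.span_zero
    cpoly_ideal.span_add cpoly_ideal.span_scale)

lemma ideal_gen_minimal: "S \<subseteq> J \<Longrightarrow> cpoly_ideal.subspace J \<Longrightarrow> ideal_gen S \<subseteq> J"
  unfolding ideal_gen_def by (rule cpoly_ideal.span_minimal)

lemma ideal_sum_gen: "ideal_sum (ideal_gen S) (ideal_gen T) = ideal_gen (S \<union> T)"
  by (simp add: ideal_sum_def ideal_gen_def cpoly_ideal.span_Un)

text \<open>The two factors are expanded in turn: the right one against a fixed generator
  \<open>s\<close>, then the left one against a fixed ideal element \<open>g\<close>.\<close>

lemma ideal_prod_gen:
  "ideal_prod (ideal_gen S) (ideal_gen T) = ideal_gen {s * t | s t. s \<in> S \<and> t \<in> T}"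
  (is "?L = ideal_gen ?G")
proof
  have 1: "s * g \<in> ideal_gen ?G" if s: "s \<in> S" and g: "g \<in> ideal_gen T" for s g
    using g
  proof (rule ideal_genE)
    fix c t f assume t: "t \<in> T" and f: "s * f \<in> ideal_gen ?G"
    have "s * t \<in> ideal_gen ?G" using s t by (blast intro: ideal_gen_base)
    then have "c * (s * t) + s * f \<in> ideal_gen ?G"
      using f by (intro ideal_gen_add[OF ideal_gen_mult])
    moreover have "s * (c * t + f) = c * (s * t) + s * f"
      by (simp only: distrib_left mult.left_commute)
    ultimately show "s * (c * t + f) \<in> ideal_gen ?G"
      by simp
  qed (simp add: ideal_gen_0)
  have 2: "f * g \<in> ideal_gen ?G" if f: "f \<in> ideal_gen S" and g: "g \<in> ideal_gen T" for f g
    using f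
  proof (rule ideal_genE)
    fix c s f assume "s \<in> S" and f: "f * g \<in> ideal_gen ?G"
    then have "c * (s * g) + f * g \<in> ideal_gen ?G"
      using 1[OF _ g] by (intro ideal_gen_add[OF ideal_gen_mult])
    then show "(c * s + f) * g \<in> ideal_gen ?G"
      by (simp only: distrib_right mult.assoc)
  qed (simp add: ideal_gen_0)
  show "?L \<subseteq> ideal_gen ?G"
    unfolding ideal_prod_def by (rule ideal_gen_minimal[OF _ subspace_ideal_gen]) (use 2 in blast)
  have "s * t \<in> {f * g |f g. f \<in> ideal_gen S \<and> g \<in> ideal_gen T}"
    if "s \<in> S" "t \<in> T" for s t
    using ideal_gen_base[OF that(1)] ideal_gen_base[OF that(2)] by blast
  then show "ideal_gen ?G \<subseteq> ?L"
    unfolding ideal_prod_def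
    by (intro ideal_gen_minimal[OF _ subspace_ideal_gen]) (blast intro: ideal_gen_base)
qed

lemma sol_space_ideal_gen: "p \<in> sol_space (ideal_gen S) \<longleftrightarrow> (\<forall>f\<in>S. f \<rhd> p = 0)"
proof
  assume *: "\<forall>f\<in>S. f \<rhd> p = 0"
  have "f \<rhd> p = 0" if "f \<in> ideal_gen S" for f
    using that by (rule ideal_genE) (simp_all add: * diff_act_add_left diff_act_mult)
  then show "p \<in> sol_space (ideal_gen S)" by (simp add: sol_space_def)
qed (auto simp: sol_space_def intro: ideal_gen_base)

text \<open>An ideal contains g f for every operator g, so the perp condition makes f \<bullet> p
  pair to zero with all operators, and the pairing separates polynomials.\<close>

lemma perp_space_eq_sol_space:
  assumes "cpoly_ideal.subspace J"
  shows "perp_space J = sol_space J"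
proof
  show "sol_space J \<subseteq> perp_space J"
    by (auto simp: perp_space_def sol_space_def poly_eval_0)
  show "perp_space J \<subseteq> sol_space J"
  proof (clarsimp simp: perp_space_def sol_space_def)
    fix p f assume *: "\<forall>f\<in>J. poly_eval (f \<rhd> p) 0 = 0" and "f \<in> J"
    then have "poly_eval (g \<rhd> (f \<rhd> p)) 0 = 0" for g
      using cpoly_ideal.subspace_scale[OF assms, of f g] by (simp add: diff_act_mult[symmetric])
    then show "f \<rhd> p = 0" by (intro pairing_ext) (simp add: poly_eval_0)
  qed
qed

section \<open>Degree truncation and homogeneous ideals\<close>

definition tdeg :: "nat^'n::finite \<Rightarrow> nat"
  where "tdeg a = (\<Sum>j\<in>UNIV. a $ j)"

definition homogeneous :: "nat \<Rightarrow> 'n::finite cpoly \<Rightarrow> bool"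
  where "homogeneous d f \<longleftrightarrow> (\<forall>a\<in>Poly_Mapping.keys f. tdeg a = d)"

definition trunc :: "nat \<Rightarrow> 'n::finite cpoly \<Rightarrow> 'n cpoly"
  where "trunc n f =
    (\<Sum>a | a \<in> Poly_Mapping.keys f \<and> tdeg a \<le> n. Poly_Mapping.single a (Poly_Mapping.lookup f a))"

lemma tdeg_add: "tdeg (a + b) = tdeg a + tdeg b"
  by (simp add: tdeg_def sum.distrib)

lemma finite_tdeg_le: "finite {a :: nat^'n::finite. tdeg a \<le> n}"
proof (rule finite_subset)
  show "{a :: nat^'n. tdeg a \<le> n} \<subseteq> vec_lambda ` (UNIV \<rightarrow>\<^sub>E {..n})"
  proof
    fix a :: "nat^'n" assume "a \<in> {a. tdeg a \<le> n}"
    then have "a $ j \<le> n" for j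
      unfolding tdeg_def using member_le_sum[of j UNIV "($) a"] by fastforce
    then show "a \<in> vec_lambda ` (UNIV \<rightarrow>\<^sub>E {..n})"
      by (intro image_eqI[of _ _ "($) a"]) auto
  qed
qed (simp add: finite_PiE)

lemma lookup_trunc:
  "Poly_Mapping.lookup (trunc n f) a = (if tdeg a \<le> n then Poly_Mapping.lookup f a else 0)"
proof -
  have "Poly_Mapping.lookup (trunc n f) a =
      (\<Sum>b | b \<in> Poly_Mapping.keys f \<and> tdeg b \<le> n. if b = a then Poly_Mapping.lookup f b else 0)"
    unfolding trunc_def lookup_sum by (rule sum.cong) (auto simp: lookup_single when_def)
  then show ?thesis by (simp add: in_keys_iff)
qed

lemma trunc_add: "trunc n (f + g) = trunc n f + trunc n g"
  by (rule poly_mapping_eqI) (simp add: lookup_trunc lookup_add)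

lemma trunc_0 [simp]: "trunc n 0 = 0"
  by (rule poly_mapping_eqI) (simp add: lookup_trunc)

lemma keys_trunc: "Poly_Mapping.keys (trunc n f) = {a \<in> Poly_Mapping.keys f. tdeg a \<le> n}"
  by (auto simp: in_keys_iff lookup_trunc split: if_splits)

lemma trunc_id: "(\<And>a. a \<in> Poly_Mapping.keys f \<Longrightarrow> tdeg a \<le> n) \<Longrightarrow> trunc n f = f"
  by (rule poly_mapping_eqI) (auto simp: lookup_trunc in_keys_iff)

lemma trunc_eq_0: "(\<And>a. a \<in> Poly_Mapping.keys f \<Longrightarrow> n < tdeg a) \<Longrightarrow> trunc n f = 0"
  by (rule poly_mapping_eqI) (metis in_keys_iff leD lookup_trunc lookup_zero)

text \<open>Multiplication by \<open>g\<close> raises all degrees by d, so the part of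
  \<open>f\<close> above degree n contributes above degree n + d only.\<close>

lemma trunc_mult_homogeneous:
  assumes "homogeneous d g"
  shows "trunc (n + d) (f * g) = trunc n f * g" "n < d \<Longrightarrow> trunc n (f * g) = 0"
proof -
  have keys: "\<exists>b\<in>Poly_Mapping.keys h. tdeg a = tdeg b + d" if "a \<in> Poly_Mapping.keys (h * g)" for h a
    using that keys_mult[of h g] assms by (fastforce simp: tdeg_add homogeneous_def)
  let ?r = "f - trunc n f"
  have r: "n < tdeg b" if "b \<in> Poly_Mapping.keys ?r" for b
    using that by (auto simp: in_keys_iff lookup_minus lookup_trunc not_le split: if_splits)
  have "f * g = trunc n f * g + ?r * g"
    by (simp add: algebra_simps)
  moreover have "trunc (n + d) (trunc n f * g) = trunc n f * g"
    by (rule trunc_id) (use keys[of _ "trunc n f"] in \<open>force simp: keys_trunc\<close>)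
  moreover have "trunc (n + d) (?r * g) = 0"
    by (rule trunc_eq_0) (use keys[of _ ?r] r in fastforce)
  ultimately show "trunc (n + d) (f * g) = trunc n f * g"
    by (metis trunc_add add_0_right)
  show "trunc n (f * g) = 0" if "n < d"
    by (rule trunc_eq_0) (use keys[of _ f] that in fastforce)
qed

lemma trunc_const_mult: "trunc n (cpoly_const c * f) = cpoly_const c * trunc n f"
proof -
  have "homogeneous 0 (cpoly_const c :: 'n::finite cpoly)" for c
    by (auto simp: homogeneous_def cpoly_const_def tdeg_def)
  from trunc_mult_homogeneous(1)[OF this, of n f c] show ?thesis by (simp add: mult.commute)
qed

lemma homogeneous_mult: "homogeneous d f \<Longrightarrow> homogeneous e g \<Longrightarrow> homogeneous (d + e) (f * g)"
  using keys_mult[of f g] by (fastforce simp: homogeneous_def tdeg_add)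

text \<open>With homogeneous generators, truncating a multiple of a generator amounts to truncating
  its cofactor. Homogeneity of an ideal enters the duality in this form.\<close>

lemma trunc_ideal_gen:
  assumes "\<And>g. g \<in> S \<Longrightarrow> \<exists>d. homogeneous d g" "f \<in> ideal_gen S"
  shows "trunc n f \<in> ideal_gen S"
  using assms(2)
proof (rule ideal_genE)
  fix c g f assume g: "g \<in> S" and f: "trunc n f \<in> ideal_gen S"
  obtain d where d: "homogeneous d g" using assms(1)[OF g] by blast
  have "trunc n (c * g) \<in> ideal_gen S"
  proof (cases "n < d")
    case False
    with trunc_mult_homogeneous(1)[OF d, of "n - d" c] g show ?thesis
      by (simp add: ideal_gen_mult ideal_gen_base)
  qed (use trunc_mult_homogeneous(2)[OF d] in \<open>simp add: ideal_gen_0\<close>)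
  with f show "trunc n (c * g + f) \<in> ideal_gen S"
    by (simp add: trunc_add ideal_gen_add)
qed (simp add: ideal_gen_0)

section \<open>Duality between ideals and spaces of polynomials\<close>

text \<open>The prescribed map is matched on a basis of \<open>T\<close> and extended from
  there.\<close>

lemma (in vector_space_pair) linear_extend_subspace:
  assumes T: "vs1.subspace T"
    and add: "\<And>x y. x \<in> T \<Longrightarrow> y \<in> T \<Longrightarrow> g (x + y) = g x + g y"
    and scale: "\<And>c x. x \<in> T \<Longrightarrow> g (s1 c x) = s2 c (g x)"
  shows "\<exists>l. Vector_Spaces.linear s1 s2 l \<and> (\<forall>x\<in>T. l x = g x)"
proof -
  obtain B where B: "B \<subseteq> T" "vs1.independent B" "T \<subseteq> vs1.span B"
    using vs1.maximal_independent_subset by blast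
  obtain l where l: "Vector_Spaces.linear s1 s2 l" "\<forall>x\<in>B. l x = g x"
    using linear_independent_extend[OF B(2)] by blast
  interpret l: Vector_Spaces.linear s1 s2 l by fact
  have "0 \<in> T" using T by (rule vs1.subspace_0)
  then have "g 0 = 0" using add[of 0 0] by simp
  have "x \<in> T \<and> l x = g x" if "x \<in> vs1.span B" for x
    using that
  proof (rule vs1.span_induct_alt)
    show "0 \<in> T \<and> l 0 = g 0" using \<open>0 \<in> T\<close> \<open>g 0 = 0\<close> l.zero by simp
  next
    fix c x y assume "x \<in> B" "y \<in> T \<and> l y = g y"
    then show "s1 c x + y \<in> T \<and> l (s1 c x + y) = g (s1 c x + y)"
      using T B(1) l(2)
      by (auto simp: l.add l.scale add scale vs1.subspace_add vs1.subspace_scale subset_iff)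
  qed
  with B(3) l(1) show ?thesis by blast
qed

text \<open>On S + range h the rule s + h x \<mapsto> m x is well defined because h x \<in> S forces
  m x = 0. It vanishes on S and extends to the whole space.\<close>

lemma (in vector_space_pair) linear_factor_through:
  assumes S: "vs1.subspace S" and h: "Vector_Spaces.linear s1 s1 h" and m: "Vector_Spaces.linear s1 s2 m"
    and ker: "\<And>x. h x \<in> S \<Longrightarrow> m x = 0"
  shows "\<exists>l. Vector_Spaces.linear s1 s2 l \<and> (\<forall>x\<in>S. l x = 0) \<and> (\<forall>x. l (h x) = m x)"
proof -
  interpret h: Vector_Spaces.linear s1 s1 h by fact
  interpret m: Vector_Spaces.linear s1 s2 m by fact
  \<comment> \<open>\<open>T\<close> is S + range h, and \<open>g\<close> applies \<open>m\<close>
    to an arbitrary choice of x; the fact \<open>g\<close> below shows independence of that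
    choice.\<close>
  define T where "T = {t. \<exists>x. t - h x \<in> S}"
  define g where "g t = m (SOME x. t - h x \<in> S)" for t
  have g: "g t = m x" if "t - h x \<in> S" for t x
  proof -
    let ?y = "SOME x. t - h x \<in> S"
    have "t - h ?y \<in> S" using that by (rule someI)
    then have "h (x - ?y) \<in> S"
      using vs1.subspace_diff[OF S, of "t - h ?y" "t - h x"] that by (simp add: h.diff)
    with ker m.diff show ?thesis by (force simp: g_def)
  qed
  have add: "(t + t') - h (x + x') \<in> S" if "t - h x \<in> S" "t' - h x' \<in> S" for t t' x x'
    using vs1.subspace_add[OF S that] by (simp add: h.add algebra_simps)
  have scale: "s1 c t - h (s1 c x) \<in> S" if "t - h x \<in> S" for t x c
    using vs1.subspace_scale[OF S that, of c] by (simp add: h.scale vs1.scale_right_diff_distrib)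
  have S0: "t - h 0 \<in> S" if "t \<in> S" for t using that h.zero by simp
  have "vs1.subspace T"
    unfolding vs1.subspace_def T_def using add scale S0[OF vs1.subspace_0[OF S]] by blast
  moreover have "g (t + t') = g t + g t'" if tt: "t \<in> T" "t' \<in> T" for t t'
  proof -
    obtain x x' where *: "t - h x \<in> S" "t' - h x' \<in> S" using tt unfolding T_def by blast
    show ?thesis using g[OF *(1)] g[OF *(2)] g[OF add[OF *]] m.add by simp
  qed
  moreover have "g (s1 c t) = s2 c (g t)" if tt: "t \<in> T" for t c
  proof -
    obtain x where *: "t - h x \<in> S" using tt unfolding T_def by blast
    show ?thesis using g[OF *] g[OF scale[OF *]] m.scale by simp
  qed
  ultimately obtain l where l: "Vector_Spaces.linear s1 s2 l" "\<forall>x\<in>T. l x = g x"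
    using linear_extend_subspace by blast
  have "t \<in> T \<and> g t = 0" if "t \<in> S" for t
  proof
    show "t \<in> T" using S0[OF that] unfolding T_def by blast
    show "g t = 0" using g[OF S0[OF that]] m.zero by simp
  qed
  moreover have "h x \<in> T \<and> g (h x) = m x" for x
    using g[of "h x" x] vs1.subspace_0[OF S] by (auto simp: T_def intro: exI[of _ x])
  ultimately show ?thesis using l by auto
qed

lemma linear_functional_eq_sum:
  assumes "Vector_Spaces.linear (\<lambda>c (f :: 'n::finite cpoly). cpoly_const c * f) ((*) :: complex \<Rightarrow> _) l"
  shows "l f = (\<Sum>a\<in>Poly_Mapping.keys f. Poly_Mapping.lookup f a * l (mon a))"
proof -
  interpret l: Vector_Spaces.linear "\<lambda>c (f :: 'n cpoly). cpoly_const c * f" "(*) :: complex \<Rightarrow> _" l by fact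
  show ?thesis
  proof (induction f rule: poly_mapping_single_induct)
    case (single a c)
    have "Poly_Mapping.single a c = cpoly_const c * mon a"
      by (simp add: cpoly_const_def mon_def mult_single)
    then show ?case by (subst sum_keys_single) (simp_all add: l.scale)
  next
    case (add f g)
    then show ?case
      using sum_keys_add[of "\<lambda>a c. c * l (mon a)" f g] by (simp add: l.add algebra_simps)
  qed (simp add: l.zero)
qed

text \<open>Finds a solution of Q with prescribed pairings against the image of \<open>h\<close>.
  The functional is built to vanish on every f whose truncation at degree n lies in Q; it then
  depends on finitely many coefficients and is the pairing with a polynomial.\<close>

lemma poly_functional_extension:
  fixes Q :: "'n::finite cpoly set" and h :: "'n cpoly \<Rightarrow> 'n cpoly" and m :: "'n cpoly \<Rightarrow> complex"
  assumes Q: "cpoly_ideal.subspace Q" "\<And>f n. f \<in> Q \<Longrightarrow> trunc n f \<in> Q"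
    and h: "\<And>f g. h (f + g) = h f + h g" "\<And>c f. h (cpoly_const c * f) = cpoly_const c * h f"
    and m: "\<And>f g. m (f + g) = m f + m g" "\<And>c f. m (cpoly_const c * f) = c * m f"
    and ker: "\<And>f. trunc n (h f) \<in> Q \<Longrightarrow> m f = 0"
  shows "\<exists>p\<in>sol_space Q. \<forall>f. poly_eval (h f \<rhd> p) 0 = m f"
proof -
  let ?s = "\<lambda>c (f :: 'n cpoly). cpoly_const c * f"
  let ?S = "{f. trunc n f \<in> Q}"
  have "cpoly_pair.vs1.subspace ?S"
    unfolding cpoly_pair.vs1.subspace_def using Q(1)
    by (auto simp: trunc_add trunc_const_mult cpoly_ideal.subspace_add
      cpoly_ideal.subspace_scale cpoly_ideal.subspace_0)
  moreover have "Vector_Spaces.linear ?s ?s h" "Vector_Spaces.linear ?s (*) m"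
    by (unfold_locales; simp add: h m)+
  ultimately obtain l where l: "Vector_Spaces.linear ?s (*) l" "\<forall>f\<in>?S. l f = 0" "\<forall>f. l (h f) = m f"
    using cpoly_pair.linear_factor_through[of ?S h m] ker by auto
  interpret l: Vector_Spaces.linear ?s "(*) :: complex \<Rightarrow> _" l by fact
  \<comment> \<open>Cutting off above degree n keeps p a polynomial and loses nothing, since
    \<open>l\<close> vanishes on all monomials of higher degree.\<close>
  have "{a. (if tdeg a \<le> n then l (mon a) else 0) \<noteq> 0} \<subseteq> {a :: nat^'n. tdeg a \<le> n}"
    by auto
  from dcoef_exists[OF finite_subset[OF this finite_tdeg_le]]
  obtain p where p: "\<And>a. dcoef p a = (if tdeg a \<le> n then l (mon a) else 0)" by blast
  have trunc_l: "l (f - trunc n f) = 0" for f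
  proof -
    have "trunc n (f - trunc n f) = 0"
      by (rule poly_mapping_eqI) (simp add: lookup_trunc lookup_minus)
    then show ?thesis using l(2) cpoly_ideal.subspace_0[OF Q(1)] by simp
  qed
  have pair: "poly_eval (f \<rhd> p) 0 = l f" for f
  proof -
    have "poly_eval (f \<rhd> p) 0 =
        (\<Sum>a\<in>Poly_Mapping.keys (trunc n f). Poly_Mapping.lookup (trunc n f) a * l (mon a))"
      unfolding poly_eval_diff_act keys_trunc
      by (rule sum.mono_neutral_cong_right) (auto simp: p lookup_trunc)
    also have "\<dots> = l f"
      using linear_functional_eq_sum[OF l(1), of "trunc n f"] trunc_l[of f] by (simp add: l.diff)
    finally show ?thesis .
  qed
  \<comment> \<open>Q is closed under truncation, so it lies in the set on which \<open>l\<close>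
    vanishes.\<close>
  then have "p \<in> perp_space Q"
    using l(2) Q(2) by (simp add: perp_space_def)
  then have "p \<in> sol_space Q" using perp_space_eq_sol_space[OF Q(1)] by simp
  with pair l(3) show ?thesis by (intro bexI[of _ p]) auto
qed

lemma ex_tdeg_bound: "\<exists>n. \<forall>a\<in>Poly_Mapping.keys f. tdeg a \<le> n"
  by (rule exI[of _ "\<Sum>a\<in>Poly_Mapping.keys f. tdeg a"]) (auto intro: member_le_sum)

text \<open>For f outside Q there is a functional vanishing on Q with value 1 at f. Realised as the
  pairing with a solution p, it contradicts f \<bullet> p = 0.\<close>

lemma annihilator_sol_space:
  fixes Q :: "'n::finite cpoly set"
  assumes Q: "cpoly_ideal.subspace Q" "\<And>f n. f \<in> Q \<Longrightarrow> trunc n f \<in> Q"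
  shows "annihilator (sol_space Q) = Q"
proof
  show "Q \<subseteq> annihilator (sol_space Q)" by (auto simp: annihilator_def sol_space_def)
  show "annihilator (sol_space Q) \<subseteq> Q"
  proof
    fix f assume f: "f \<in> annihilator (sol_space Q)"
    obtain n where n: "\<forall>a\<in>Poly_Mapping.keys f. tdeg a \<le> n" using ex_tdeg_bound by blast
    show "f \<in> Q"
    proof (rule ccontr)
      assume "f \<notin> Q"
      \<comment> \<open>The constant coefficient of \<open>g\<close> stands for a scalar:
        \<open>h\<close> must be defined on the polynomial ring, and its image here is the line
        spanned by \<open>f\<close>.\<close>
      have "\<exists>p\<in>sol_space Q. \<forall>g :: 'n cpoly. poly_eval ((cpoly_const (Poly_Mapping.lookup g 0) * f) \<rhd> p) 0 =
          Poly_Mapping.lookup g 0"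
      proof (rule poly_functional_extension[OF Q,
            where h = "\<lambda>g. cpoly_const (Poly_Mapping.lookup g 0) * f"
            and m = "\<lambda>g. Poly_Mapping.lookup g 0" and n = n])
        fix g :: "'n cpoly" assume *: "trunc n (cpoly_const (Poly_Mapping.lookup g 0) * f) \<in> Q"
        show "Poly_Mapping.lookup g 0 = 0"
        proof (rule ccontr)
          assume nz: "Poly_Mapping.lookup g 0 \<noteq> 0"
          have "cpoly_const (Poly_Mapping.lookup g 0) * f \<in> Q"
            using * n by (simp add: trunc_const_mult trunc_id)
          from cpoly_ideal.subspace_scale[OF Q(1) this, of "cpoly_const (1 / Poly_Mapping.lookup g 0)"]
          have "cpoly_const (1 / Poly_Mapping.lookup g 0 * Poly_Mapping.lookup g 0) * f \<in> Q"
            unfolding cpoly_const_mult mult.assoc .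
          with nz \<open>f \<notin> Q\<close> show False by simp
        qed
      qed (simp_all only: lookup_add cpoly_const_add lookup_const_mult cpoly_const_mult distrib_right mult.assoc)
      then obtain p where p: "p \<in> sol_space Q"
        "\<And>g :: 'n cpoly. poly_eval ((cpoly_const (Poly_Mapping.lookup g 0) * f) \<rhd> p) 0 = Poly_Mapping.lookup g 0"
        by blast
      from p(2)[of 1] have "poly_eval (f \<rhd> p) 0 = 1" by simp
      with f p(1) show False by (simp add: annihilator_def poly_eval_0)
    qed
  qed
qed

lemma subspace_ideal_colon:
  "cpoly_ideal.subspace Q \<Longrightarrow> cpoly_ideal.subspace (ideal_colon Q m)"
  unfolding cpoly_ideal.subspace_def ideal_colon_def mem_Collect_eq distrib_right mult.assoc mult_zero_left
  by blast

text \<open>For surjectivity, a preimage p' of p must pair with f m as p does with f. These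
  prescriptions are consistent: if f m lies in Q, then f lies in the colon ideal, which kills
  p.\<close>

lemma sol_space_colon:
  fixes Q :: "'n::finite cpoly set"
  assumes Q: "cpoly_ideal.subspace Q" "\<And>f n. f \<in> Q \<Longrightarrow> trunc n f \<in> Q"
    and m: "homogeneous d m"
  shows "sol_space (ideal_colon Q m) = (\<lambda>p. m \<rhd> p) ` sol_space Q"
proof
  show "(\<lambda>p. m \<rhd> p) ` sol_space Q \<subseteq> sol_space (ideal_colon Q m)"
    by (auto simp: sol_space_def ideal_colon_def diff_act_mult[symmetric])
  show "sol_space (ideal_colon Q m) \<subseteq> (\<lambda>p. m \<rhd> p) ` sol_space Q"
  proof
    fix p assume p: "p \<in> sol_space (ideal_colon Q m)"
    obtain k where k: "\<forall>a\<in>Poly_Mapping.keys p. tdeg a \<le> k" using ex_tdeg_bound by blast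
    \<comment> \<open>Terms of f above the degree of p pair to zero with p. Truncating f at k
      corresponds to truncating f m at k + d.\<close>
    have tr: "poly_eval (trunc k f \<rhd> p) 0 = poly_eval (f \<rhd> p) 0" for f
      unfolding poly_eval_diff_act keys_trunc
      by (rule sum.mono_neutral_cong_left)
        (use k in \<open>auto simp: lookup_trunc dcoef_eq_0_iff in_keys_iff\<close>)
    have "\<exists>p'\<in>sol_space Q. \<forall>f. poly_eval ((f * m) \<rhd> p') 0 = poly_eval (f \<rhd> p) 0"
    proof (rule poly_functional_extension[OF Q, where h = "\<lambda>f. f * m"
          and m = "\<lambda>f. poly_eval (f \<rhd> p) 0" and n = "k + d"])
      fix f assume "trunc (k + d) (f * m) \<in> Q"
      then have "trunc k f \<in> ideal_colon Q m"
        by (simp add: trunc_mult_homogeneous[OF m] ideal_colon_def)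
      with p have "trunc k f \<rhd> p = 0" by (simp add: sol_space_def)
      with tr[of f] show "poly_eval (f \<rhd> p) 0 = 0" by (simp add: poly_eval_0)
    next
      show "poly_eval ((cpoly_const c * f) \<rhd> p) 0 = c * poly_eval (f \<rhd> p) 0" for c f
        by (simp add: diff_act_mult poly_eval_0) (simp add: cpoly_const_def)
    qed (simp_all only: distrib_right mult.assoc diff_act_add_left poly_eval_add)
    then obtain p' where p': "p' \<in> sol_space Q"
      "\<And>f. poly_eval ((f * m) \<rhd> p') 0 = poly_eval (f \<rhd> p) 0" by blast
    have "m \<rhd> p' = p"
      by (rule pairing_ext) (simp only: p'(2)[symmetric] diff_act_mult)
    with p'(1) show "p \<in> (\<lambda>p. m \<rhd> p) ` sol_space Q" by blast
  qed
qed

lemma annihilator_image: "annihilator ((\<lambda>p. m \<rhd> p) ` V) = ideal_colon (annihilator V) m"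
  by (auto simp: annihilator_def ideal_colon_def diff_act_mult)

section \<open>Square-free monomials and negative supports\<close>

definition ind_vec :: "'n set \<Rightarrow> nat^'n::finite"
  where "ind_vec S = (\<chi> j. if j \<in> S then 1 else 0)"

lemma ind_vec_Un: "S \<inter> T = {} \<Longrightarrow> ind_vec (S \<union> T) = ind_vec S + ind_vec T"
  by (auto simp: ind_vec_def vec_eq_iff)

lemma sqfree_mon_eq_mon: "sqfree_mon S = mon (ind_vec S)"
proof -
  have "finite S" by simp
  then show ?thesis
  proof induction
    case empty
    have "ind_vec {} = (0 :: nat^'a)" by (simp add: ind_vec_def vec_eq_iff)
    then show ?case by (simp add: sqfree_mon_def mon_def)
  next
    case (insert j S)
    have "axis j 1 = ind_vec {j}" by (simp add: ind_vec_def axis_def vec_eq_iff)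
    then have "ind_vec (insert j S) = axis j 1 + ind_vec S"
      using ind_vec_Un[of "{j}" S] insert by simp
    with insert show ?case by (simp add: sqfree_mon_def mon_def var_def mult_single)
  qed
qed

lemma sqfree_mon_Un: "S \<inter> T = {} \<Longrightarrow> sqfree_mon (S \<union> T) = sqfree_mon S * sqfree_mon T"
  by (simp add: sqfree_mon_def prod.union_disjoint)

lemma sqfree_mon_diff_trans:
  "K \<subseteq> I \<Longrightarrow> I \<subseteq> T \<Longrightarrow> sqfree_mon (T - K) = sqfree_mon (T - I) * sqfree_mon (I - K)"
  by (subst sqfree_mon_Un[symmetric]) (auto intro: arg_cong[where f = sqfree_mon])

lemma sqfree_mon_prod_UNIV: "sqfree_mon S = (\<Prod>j\<in>UNIV. if j \<in> S then var j else 1)"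
  by (simp add: sqfree_mon_def prod.If_cases)

lemma dcoef_sqfree_act: "dcoef (sqfree_mon S \<rhd> p) a = dcoef p (a + ind_vec S)"
  by (simp add: sqfree_mon_eq_mon mon_def)

text \<open>The coefficient of p at \<open>a\<close> is forced to be that of \<open>q I\<close> at
  \<open>a - ind_vec (I - K)\<close> whenever \<open>ind_vec (I - K) \<le> a\<close>. Compatibility
  makes this independent of I; coefficients reached by no I are set to 0.\<close>

lemma sqfree_mon_glue:
  fixes q :: "'n::finite set \<Rightarrow> 'n cpoly"
  assumes K: "\<And>I. I \<in> N \<Longrightarrow> K \<subseteq> I"
    and compat: "\<And>I J. I \<in> N \<Longrightarrow> J \<in> N \<Longrightarrow> sqfree_mon (J - I) \<rhd> q I = sqfree_mon (I - J) \<rhd> q J"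
  shows "\<exists>p. \<forall>I\<in>N. sqfree_mon (I - K) \<rhd> p = q I"
proof -
  define sel where "sel a = (SOME I. I \<in> N \<and> ind_vec (I - K) \<le> a)" for a
  define c where "c a = (if \<exists>I\<in>N. ind_vec (I - K) \<le> a
    then dcoef (q (sel a)) (a - ind_vec (sel a - K)) else 0)" for a
  have sub: "a - ind_vec S + ind_vec S = a" if "ind_vec S \<le> a" for a and S :: "'n set"
    using that by (auto simp: vec_eq_iff less_eq_vec_def)
  have eq: "dcoef (q I) (a - ind_vec (I - K)) = dcoef (q J) (a - ind_vec (J - K))"
    if I: "I \<in> N" "ind_vec (I - K) \<le> a" and J: "J \<in> N" "ind_vec (J - K) \<le> a" for a I J
  proof -
    have U: "ind_vec (I \<union> J - K) \<le> a"
      using I(2) J(2) by (auto simp: less_eq_vec_def ind_vec_def split: if_splits)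
    \<comment> \<open>Since K is contained in I, the set (I \<union> J) - K is the disjoint union of
      J - I and I - K. Both sides of the compatibility are therefore read at one common
      index.\<close>
    have *: "dcoef (sqfree_mon (J - I) \<rhd> q I) (a - ind_vec (I \<union> J - K)) =
        dcoef (q I) (a - ind_vec (I - K))" if "K \<subseteq> I" "ind_vec (I \<union> J - K) \<le> a" for I J
    proof -
      have "ind_vec (I \<union> J - K) = ind_vec (J - I) + ind_vec (I - K)"
        using that(1) by (subst ind_vec_Un[symmetric]) (auto intro: arg_cong[where f = ind_vec])
      moreover from this that(2) have "ind_vec (J - I) + ind_vec (I - K) \<le> a" by simp
      then have "a $ j - (ind_vec (J - I) $ j + ind_vec (I - K) $ j) + ind_vec (J - I) $ j =
          a $ j - ind_vec (I - K) $ j" for j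
      proof -
        have "ind_vec (J - I) $ j + ind_vec (I - K) $ j \<le> a $ j"
          using \<open>ind_vec (J - I) + ind_vec (I - K) \<le> a\<close> by (simp add: less_eq_vec_def)
        then show ?thesis by linarith
      qed
      ultimately have "a - ind_vec (I \<union> J - K) + ind_vec (J - I) = a - ind_vec (I - K)"
        by (simp add: vec_eq_iff)
      then show ?thesis by (simp add: dcoef_sqfree_act)
    qed
    show ?thesis
      using *[OF K[OF I(1)] U] *[OF K[OF J(1)], of I] U compat[OF I(1) J(1)] by (simp add: Un_commute)
  qed
  have c_eq: "c a = dcoef (q I) (a - ind_vec (I - K))" if "I \<in> N" "ind_vec (I - K) \<le> a" for a I
  proof -
    have "sel a \<in> N \<and> ind_vec (sel a - K) \<le> a"
      unfolding sel_def by (rule someI[of _ I]) (use that in simp)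
    then have "dcoef (q (sel a)) (a - ind_vec (sel a - K)) = dcoef (q I) (a - ind_vec (I - K))"
      using eq that by blast
    moreover have "\<exists>I\<in>N. ind_vec (I - K) \<le> a" using that by blast
    ultimately show ?thesis by (simp only: c_def if_True)
  qed
  \<comment> \<open>\<open>N\<close> consists of subsets of a finite type, hence is finite, and each
    \<open>q I\<close> has finite support.\<close>
  have "{a. c a \<noteq> 0} \<subseteq> (\<Union>I\<in>N. (\<lambda>b. b + ind_vec (I - K)) ` Poly_Mapping.keys (q I))"
  proof
    fix a assume "a \<in> {a. c a \<noteq> 0}"
    then have "c a \<noteq> 0" by simp
    then obtain I where I: "I \<in> N" "ind_vec (I - K) \<le> a" unfolding c_def by (auto split: if_splits)
    with \<open>c a \<noteq> 0\<close> c_eq[OF I] have "a - ind_vec (I - K) \<in> Poly_Mapping.keys (q I)"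
      by (auto simp: in_keys_iff dcoef_eq_0_iff)
    then have "a \<in> (\<lambda>b. b + ind_vec (I - K)) ` Poly_Mapping.keys (q I)"
      using sub[OF I(2)] by (metis imageI)
    with I(1) show "a \<in> (\<Union>I\<in>N. (\<lambda>b. b + ind_vec (I - K)) ` Poly_Mapping.keys (q I))" by blast
  qed
  then have "finite {a. c a \<noteq> 0}" by (rule finite_subset) simp
  then obtain p where p: "\<And>a. dcoef p a = c a" using dcoef_exists by blast
  have "sqfree_mon (I - K) \<rhd> p = q I" if "I \<in> N" for I
  proof (rule dcoef_eqI)
    fix a
    have "ind_vec (I - K) \<le> a + ind_vec (I - K)" by (simp add: less_eq_vec_def)
    from c_eq[OF that this] show "dcoef (sqfree_mon (I - K) \<rhd> p) a = dcoef (q I) a"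
      by (simp add: dcoef_sqfree_act p)
  qed
  then show ?thesis by blast
qed

section \<open>Units modulo high order\<close>

text \<open>The bound is strict, so \<open>k = 0\<close> leaves the zero polynomial alone; this is
  the base case of the nilpotency argument.\<close>

definition deg_less :: "nat \<Rightarrow> 'n::finite cpoly \<Rightarrow> bool"
  where "deg_less k p \<longleftrightarrow> (\<forall>a\<in>Poly_Mapping.keys p. tdeg a < k)"

text \<open>Congruence modulo the k-th power of the ideal generated by the derivatives, expressed
  through the action. Modulo it, operators with nonzero constant term are units.\<close>

definition act_eq :: "nat \<Rightarrow> 'n::finite cpoly \<Rightarrow> 'n cpoly \<Rightarrow> bool"
  where "act_eq k f g \<longleftrightarrow> (\<forall>p. deg_less k p \<longrightarrow> f \<rhd> p = g \<rhd> p)"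

lemma deg_less_dcoef: "deg_less k p \<longleftrightarrow> (\<forall>a. dcoef p a \<noteq> 0 \<longrightarrow> tdeg a < k)"
  by (auto simp: deg_less_def dcoef_eq_0_iff in_keys_iff)

lemma deg_less_diff_act:
  assumes "deg_less k p"
  shows "deg_less k (f \<rhd> p)"
  unfolding deg_less_dcoef
proof (intro allI impI)
  fix a assume "dcoef (f \<rhd> p) a \<noteq> 0"
  then obtain b where "dcoef p (a + b) \<noteq> 0"
    unfolding dcoef_diff_act by (metis (mono_tags, lifting) mult_zero_right sum.neutral)
  then have "tdeg (a + b) < k" using assms by (simp add: deg_less_dcoef)
  then show "tdeg a < k" by (simp add: tdeg_add)
qed

lemma deg_less_mono: "deg_less k p \<Longrightarrow> k \<le> l \<Longrightarrow> deg_less l p"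
  by (auto simp: deg_less_def)

lemma ex_deg_less:
  assumes "finite S"
  shows "\<exists>k. \<forall>p\<in>S. deg_less k p"
  using assms
proof induction
  case (insert p S)
  then obtain k where k: "\<forall>p\<in>S. deg_less k p" by blast
  obtain l where l: "\<forall>a\<in>Poly_Mapping.keys p. tdeg a \<le> l" using ex_tdeg_bound by blast
  then have "deg_less (Suc l) p" by (auto simp: deg_less_def less_Suc_eq_le)
  with k have "\<forall>p\<in>insert p S. deg_less (max k (Suc l)) p"
    by (auto intro: deg_less_mono)
  then show ?case ..
qed simp

lemma act_eqD: "act_eq k f g \<Longrightarrow> deg_less k p \<Longrightarrow> f \<rhd> p = g \<rhd> p"
  by (simp add: act_eq_def)

lemma act_eq_refl [simp]: "act_eq k f f"
  by (simp add: act_eq_def)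

lemma act_eq_trans [trans]: "act_eq k f g \<Longrightarrow> act_eq k g h \<Longrightarrow> act_eq k f h"
  by (simp add: act_eq_def)

lemma act_eq_mult: "act_eq k f g \<Longrightarrow> act_eq k f' g' \<Longrightarrow> act_eq k (f * f') (g * g')"
  by (simp add: act_eq_def diff_act_mult deg_less_diff_act)

lemma act_eq_prod: "(\<And>i. i \<in> S \<Longrightarrow> act_eq k (f i) (g i)) \<Longrightarrow> act_eq k (\<Prod>i\<in>S. f i) (\<Prod>i\<in>S. g i)"
  by (induction S rule: infinite_finite_induct) (simp_all add: act_eq_mult)

text \<open>Geometric series: with x = - \<partial>_j / c the factor is c (1 - x), and x^k kills
  every polynomial of degree below k.\<close>

lemma linear_factor_inverse:
  fixes j :: "'n::finite"
  assumes "c \<noteq> 0"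
  shows "\<exists>g. act_eq k ((var j + cpoly_const c) * g) 1"
proof -
  define x :: "'n cpoly" where "x = Poly_Mapping.single (axis j 1) (- 1 / c)"
  have x: "cpoly_const c * (1 - x) = var j + cpoly_const c"
    using assms unfolding x_def cpoly_const_def var_def mon_def
    by (simp add: right_diff_distrib distrib_left mult_single single_uminus add.commute)
  have pow: "x ^ n \<rhd> p = 0" if "deg_less n p" for n p
    using that
  proof (induction n arbitrary: p)
    case 0
    then have "p = 0" by (intro dcoef_eqI) (auto simp: deg_less_dcoef)
    then show ?case by simp
  next
    case (Suc n)
    have "tdeg (axis j 1) = 1" by (simp add: tdeg_def axis_def)
    have "deg_less n (x \<rhd> p)"
      unfolding deg_less_dcoef
    proof (intro allI impI)
      fix a assume "dcoef (x \<rhd> p) a \<noteq> 0"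
      then have "dcoef p (a + axis j 1) \<noteq> 0" by (simp add: x_def)
      with Suc.prems have "tdeg (a + axis j 1) < Suc n" unfolding deg_less_dcoef by blast
      with \<open>tdeg (axis j 1) = 1\<close> show "tdeg a < n" by (simp add: tdeg_add)
    qed
    with Suc.IH show ?case by (simp add: power_Suc2 diff_act_mult del: power_Suc)
  qed
  have "(var j + cpoly_const c) * (cpoly_const (1 / c) * (\<Sum>i<k. x ^ i)) =
      cpoly_const (c * (1 / c)) * ((1 - x) * (\<Sum>i<k. x ^ i))"
    unfolding x[symmetric] cpoly_const_mult by (simp only: mult_ac)
  also have "\<dots> = 1 - x ^ k"
    using assms by (simp add: one_diff_power_eq)
  finally have "act_eq k ((var j + cpoly_const c) * (cpoly_const (1 / c) * (\<Sum>i<k. x ^ i))) 1"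
    by (simp add: act_eq_def diff_act_minus_left pow)
  then show ?thesis by blast
qed

text \<open>The value 1 at \<open>c = 0\<close> leaves out the one linear factor that is not a unit;
  the square-free monomials account for it.\<close>

definition factor :: "'n::finite \<Rightarrow> complex \<Rightarrow> 'n cpoly"
  where "factor j c = (if c = 0 then 1 else var j + cpoly_const c)"

definition factor_inv :: "nat \<Rightarrow> 'n::finite \<Rightarrow> complex \<Rightarrow> 'n cpoly"
  where "factor_inv k j c = (if c = 0 then 1 else SOME g. act_eq k ((var j + cpoly_const c) * g) 1)"

lemma factor_inv: "act_eq k (factor j c * factor_inv k j c) 1"
proof (cases "c = 0")
  case False
  from someI_ex[OF linear_factor_inverse[OF False, of k j]] False show ?thesis
    by (simp add: factor_def factor_inv_def)
qed (simp add: factor_def factor_inv_def)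

text \<open>Up to normalisation at \<open>m = 0\<close>, this is \<open>1 / \<Gamma>(t\<^sub>j + z + m + 1)\<close>, with the factor \<open>t\<^sub>j\<close> left out.\<close>

definition gamma_unit :: "nat \<Rightarrow> 'n::finite \<Rightarrow> complex \<Rightarrow> int \<Rightarrow> 'n cpoly"
  where "gamma_unit k j z m =
    (\<Prod>i\<in>{1..m}. factor_inv k j (z + of_int i)) * (\<Prod>i\<in>{m+1..0}. factor j (z + of_int i))"

definition gamma_unit_inv :: "nat \<Rightarrow> 'n::finite \<Rightarrow> complex \<Rightarrow> int \<Rightarrow> 'n cpoly"
  where "gamma_unit_inv k j z m =
    (\<Prod>i\<in>{1..m}. factor j (z + of_int i)) * (\<Prod>i\<in>{m+1..0}. factor_inv k j (z + of_int i))"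

lemma gamma_unit_inv: "act_eq k (gamma_unit k j z m * gamma_unit_inv k j z m) 1"
proof -
  have "gamma_unit k j z m * gamma_unit_inv k j z m =
      (\<Prod>i\<in>{1..m}. factor j (z + of_int i) * factor_inv k j (z + of_int i)) *
      (\<Prod>i\<in>{m+1..0}. factor j (z + of_int i) * factor_inv k j (z + of_int i))"
    by (simp only: gamma_unit_def gamma_unit_inv_def prod.distrib mult_ac)
  moreover have "act_eq k \<dots> ((\<Prod>i\<in>{1..m}. 1) * (\<Prod>i\<in>{m+1..0}. 1))"
    by (intro act_eq_mult act_eq_prod factor_inv)
  ultimately show ?thesis by simp
qed

text \<open>The recurrence s / Gamma(s + 1) = 1 / Gamma(s). For m \<ge> 1 the factor cancels an
  inverse, modulo order k; for m \<le> 0 it lengthens the product and equality is exact.\<close>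

lemma gamma_unit_step:
  fixes j :: "'n::finite"
  shows "act_eq k (factor j (z + of_int m) * gamma_unit k j z m) (gamma_unit k j z (m - 1))"
proof (cases "m \<ge> 1")
  case True
  then have "{1..m} = insert m {1..m - 1}" by auto
  then have "(\<Prod>i\<in>{1..m}. f i) = f m * (\<Prod>i\<in>{1..m - 1}. f i)" for f :: "int \<Rightarrow> 'n cpoly"
    by (simp only:) simp
  moreover have "{m + 1..0} = {}" "{m - 1 + 1..0} = {}"
    using True by auto
  ultimately have "factor j (z + of_int m) * gamma_unit k j z m =
      factor j (z + of_int m) * factor_inv k j (z + of_int m) * gamma_unit k j z (m - 1)"
    unfolding gamma_unit_def by (simp only: mult.assoc)
  then show ?thesis
    using act_eq_mult[OF factor_inv[of k j "z + of_int m"] act_eq_refl[of k "gamma_unit k j z (m - 1)"]]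
    by simp
next
  case False
  then have "{m - 1 + 1..0} = insert m {m + 1..0}" by auto
  then have "(\<Prod>i\<in>{m - 1 + 1..0}. f i) = f m * (\<Prod>i\<in>{m + 1..0}. f i)" for f :: "int \<Rightarrow> 'n cpoly"
    by (simp only:) simp
  moreover have "{1..m} = {}" "{1..m - 1} = {}"
    using False by auto
  ultimately have "gamma_unit k j z (m - 1) = factor j (z + of_int m) * gamma_unit k j z m"
    unfolding gamma_unit_def by (simp only: mult.left_commute)
  then show ?thesis by simp
qed

definition neg_int :: "complex \<Rightarrow> bool"
  where "neg_int c \<longleftrightarrow> (\<exists>k::int. k < 0 \<and> c = of_int k)"

lemma neg_int_of_int [simp]: "neg_int (of_int m) \<longleftrightarrow> m < 0"
  by (auto simp: neg_int_def)

lemma neg_int_minus_1: "neg_int (c - 1) \<longleftrightarrow> neg_int c \<or> c = 0"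
proof
  assume "neg_int (c - 1)"
  then obtain k :: int where k: "k < 0" "c - 1 = of_int k" by (auto simp: neg_int_def)
  then have "c = of_int (k + 1)" by (simp add: diff_eq_eq)
  with k(1) show "neg_int c \<or> c = 0" unfolding neg_int_def
    by (cases "k + 1 = 0") (auto intro!: exI[of _ "k + 1"])
next
  assume "neg_int c \<or> c = 0"
  then obtain k :: int where "k \<le> 0" "c = of_int k" by (force simp: neg_int_def)
  then show "neg_int (c - 1)" unfolding neg_int_def by (intro exI[of _ "k - 1"]) auto
qed

lemma neg_int_minus_of_nat: "neg_int c \<Longrightarrow> neg_int (c - of_nat b)"
  unfolding neg_int_def by (elim exE, rule_tac x = "k - int b" in exI) simp

lemma nsupp_shift_iff: "j \<in> nsupp_shift v u \<longleftrightarrow> neg_int (v $ j + of_int (u $ j))"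
  by (simp add: nsupp_shift_def nsupp_def neg_int_def complex_vec_def)

text \<open>The constants z + m, z + m - 1, ... of the falling factorial vanish at most once, where
  the exponent passes from 0 to -1. That factor is \<open>var j\<close>; the others are absorbed by
  the recurrence of the units.\<close>

lemma falling_gamma_unit:
  "act_eq k (falling (var j + cpoly_const (z + of_int m)) b * gamma_unit k j z m)
    ((if neg_int (z + of_int m - of_nat b) \<and> \<not> neg_int (z + of_int m) then var j else 1) *
      gamma_unit k j z (m - int b))"
proof (induction b)
  case (Suc b)
  define c where "c = z + of_int (m - int b)"
  have c: "z + of_int m - of_nat b = c" "z + of_int m - of_nat (Suc b) = c - 1"
    by (simp_all add: c_def)
  let ?X = "\<lambda>b. if neg_int (z + of_int m - of_nat b) \<and> \<not> neg_int (z + of_int m) then var j else 1"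
  have "falling (var j + cpoly_const (z + of_int m)) (Suc b) * gamma_unit k j z m =
      (var j + cpoly_const c) *
        (falling (var j + cpoly_const (z + of_int m)) b * gamma_unit k j z m)"
  proof -
    have "var j + cpoly_const c = var j + cpoly_const (z + of_int m) - of_nat b"
      by (simp only: c(1)[symmetric] cpoly_const_minus cpoly_const_of_nat add_diff_eq)
    then show ?thesis by (simp only: falling_Suc mult_ac)
  qed
  also have "act_eq k \<dots> ((var j + cpoly_const c) * (?X b * gamma_unit k j z (m - int b)))"
    by (rule act_eq_mult[OF act_eq_refl Suc])
  also have "(var j + cpoly_const c) * (?X b * gamma_unit k j z (m - int b)) =
      ?X (Suc b) * (factor j c * gamma_unit k j z (m - int b))"
  proof (cases "c = 0")
    \<comment> \<open>The exponent is about to become -1: the indicator switches on, and the factor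
      omitted from the unit appears as \<open>var j\<close>.\<close>
    case True
    with c(1) have "z + of_int m - of_nat b = 0" by (rule trans)
    then have zm: "z + of_int m = of_int (int b)" by simp
    have "\<not> neg_int (z + of_int m)" unfolding zm neg_int_of_int by simp
    moreover have "\<not> neg_int c" "neg_int (c - 1)"
      using neg_int_of_int[of 0] neg_int_of_int[of "-1"] True by simp_all
    ultimately have "?X b = 1" "?X (Suc b) = var j" unfolding c by simp_all
    moreover have "factor j c = 1" "var j + cpoly_const c = var j"
      using True by (simp_all add: factor_def)
    ultimately show ?thesis by (simp only: mult_1_left)
  next
    case False
    then have "neg_int (c - 1) = neg_int c" by (simp only: neg_int_minus_1 simp_thms)
    then have "?X (Suc b) = ?X b" unfolding c by (simp only:)
    moreover have "factor j c = var j + cpoly_const c" using False by (simp add: factor_def)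
    ultimately show ?thesis by (simp only: mult.left_commute)
  qed
  also have "act_eq k \<dots> (?X (Suc b) * gamma_unit k j z (m - int b - 1))"
    unfolding c_def by (rule act_eq_mult[OF act_eq_refl gamma_unit_step])
  also have "m - int b - 1 = m - int (Suc b)" by simp
  finally show ?case .
qed simp

definition gamma_unit_vec :: "nat \<Rightarrow> complex^'n \<Rightarrow> int^'n \<Rightarrow> 'n::finite cpoly"
  where "gamma_unit_vec k v u = (\<Prod>j\<in>UNIV. gamma_unit k j (v $ j) (u $ j))"

definition gamma_unit_vec_inv :: "nat \<Rightarrow> complex^'n \<Rightarrow> int^'n \<Rightarrow> 'n::finite cpoly"
  where "gamma_unit_vec_inv k v u = (\<Prod>j\<in>UNIV. gamma_unit_inv k j (v $ j) (u $ j))"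

lemma gamma_unit_vec_0 [simp]: "gamma_unit_vec k v 0 = 1" "gamma_unit_vec_inv k v 0 = 1"
  by (simp_all add: gamma_unit_vec_def gamma_unit_def gamma_unit_vec_inv_def gamma_unit_inv_def)

lemma gamma_unit_vec_inv:
  fixes v :: "complex^'n::finite"
  shows "act_eq k (gamma_unit_vec k v u * gamma_unit_vec_inv k v u) 1"
proof -
  have "act_eq k (\<Prod>j\<in>UNIV. gamma_unit k j (v $ j) (u $ j) * gamma_unit_inv k j (v $ j) (u $ j))
      (\<Prod>j\<in>(UNIV :: 'n set). 1)"
    by (rule act_eq_prod) (rule gamma_unit_inv)
  then show ?thesis by (simp add: gamma_unit_vec_def gamma_unit_vec_inv_def prod.distrib)
qed

lemma gamma_unit_vec_cancel:
  assumes "deg_less k p"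
  shows "gamma_unit_vec k v u \<rhd> gamma_unit_vec_inv k v u \<rhd> p = p"
    "gamma_unit_vec_inv k v u \<rhd> gamma_unit_vec k v u \<rhd> p = p"
  using act_eqD[OF gamma_unit_vec_inv assms, of v u]
  by (simp_all add: diff_act_mult[symmetric] mult.commute)

text \<open>A coordinate contributes its derivative exactly when it becomes a negative integer in
  passing from u to u - b. Up to units, toric operators thus become square-free monomials.\<close>

lemma log_diff_symbol_gamma_unit_vec:
  "act_eq k (log_diff_symbol (v + complex_vec u) b * gamma_unit_vec k v u)
    (sqfree_mon (nsupp_shift v (u - int_vec b) - nsupp_shift v u) * gamma_unit_vec k v (u - int_vec b))"
proof -
  let ?c = "\<lambda>j. v $ j + of_int (u $ j)"
  have "log_diff_symbol (v + complex_vec u) b * gamma_unit_vec k v u =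
      (\<Prod>j\<in>UNIV. falling (var j + cpoly_const (?c j)) (b $ j) * gamma_unit k j (v $ j) (u $ j))"
    by (simp add: log_diff_symbol_falling gamma_unit_vec_def prod.distrib complex_vec_def)
  also have "act_eq k \<dots> (\<Prod>j\<in>UNIV.
      (if neg_int (?c j - of_nat (b $ j)) \<and> \<not> neg_int (?c j) then var j else 1) *
        gamma_unit k j (v $ j) (u $ j - int (b $ j)))"
    by (intro act_eq_prod falling_gamma_unit)
  also have "\<dots> = sqfree_mon (nsupp_shift v (u - int_vec b) - nsupp_shift v u) *
      gamma_unit_vec k v (u - int_vec b)"
    by (simp add: prod.distrib sqfree_mon_prod_UNIV gamma_unit_vec_def nsupp_shift_iff int_vec_def
      add_diff_eq cong: if_cong)
  finally show ?thesis .
qed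

section \<open>Solutions of the hypergeometric system\<close>

definition euler_symbol :: "int^'n::finite^'d::finite \<Rightarrow> 'd \<Rightarrow> 'n cpoly"
  where "euler_symbol A i = (\<Sum>j\<in>UNIV. cpoly_const (of_int (A $ i $ j)) * var j)"

lemma homogeneous_sqfree_mon: "homogeneous (card S) (sqfree_mon S)"
  by (simp add: homogeneous_def sqfree_mon_eq_mon mon_def tdeg_def ind_vec_def sum.If_cases)

lemma homogeneous_euler_symbol: "homogeneous 1 (euler_symbol A i)"
proof -
  have "homogeneous 1 (\<Sum>j\<in>S. cpoly_const (c j) * var (j :: 'n::finite))" for c S
  proof (induction S rule: infinite_finite_induct)
    case (insert j S)
    have "homogeneous 1 (cpoly_const (c j) * var j)"
      by (simp add: homogeneous_def cpoly_const_mult_var tdeg_def axis_def)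
    with insert show ?case
      using keys_add[of "cpoly_const (c j) * var j" "\<Sum>j\<in>S. cpoly_const (c j) * var j"]
      by (auto simp: homogeneous_def)
  qed (simp_all add: homogeneous_def)
  then show ?thesis unfolding euler_symbol_def .
qed

text \<open>Explicit generators, all homogeneous, which makes the ideal stable under
  truncation.\<close>

definition Q_generators ::
    "int^'n::finite^'d::finite \<Rightarrow> complex^'n \<Rightarrow> 'n set set \<Rightarrow> 'n cpoly set"
  where "Q_generators A v N =
    {euler_symbol A i * sqfree_mon (I - K_set N) | i I. I \<in> N} \<union>
    {sqfree_mon (I \<union> J - K_set N) | I J. I \<in> N \<and> J \<in> NS A v - N}"

lemma Q_ideal_eq_gen: "Q_ideal A v N = ideal_gen (Q_generators A v N)"
proof -
  have "{s * t |s t. s \<in> {euler_symbol A i |i. True} \<and> t \<in> {sqfree_mon (I - K_set N) |I. I \<in> N}} =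
      {euler_symbol A i * sqfree_mon (I - K_set N) | i I. I \<in> N}"
    by blast
  then show ?thesis
    unfolding Q_ideal_def A_ideal_def M_ideal_def P_ideal_def Q_generators_def
      euler_symbol_def[symmetric] ideal_prod_gen ideal_sum_gen by simp
qed

lemma subspace_Q_ideal: "cpoly_ideal.subspace (Q_ideal A v N)"
  by (simp add: Q_ideal_eq_gen subspace_ideal_gen)

lemma trunc_Q_ideal:
  assumes "f \<in> Q_ideal A v N"
  shows "trunc n f \<in> Q_ideal A v N"
  unfolding Q_ideal_eq_gen
proof (rule trunc_ideal_gen)
  show "\<exists>d. homogeneous d g" if "g \<in> Q_generators A v N" for g
    using that homogeneous_mult[OF homogeneous_euler_symbol homogeneous_sqfree_mon]
      homogeneous_sqfree_mon unfolding Q_generators_def by blast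
qed (use assms in \<open>simp add: Q_ideal_eq_gen\<close>)

lemma sol_space_Q_ideal:
  "p \<in> sol_space (Q_ideal A v N) \<longleftrightarrow>
    (\<forall>i. \<forall>I\<in>N. euler_symbol A i \<rhd> sqfree_mon (I - K_set N) \<rhd> p = 0) \<and>
    (\<forall>I\<in>N. \<forall>J\<in>NS A v - N. sqfree_mon (I \<union> J - K_set N) \<rhd> p = 0)"
  unfolding Q_ideal_eq_gen sol_space_ideal_gen Q_generators_def diff_act_mult[symmetric] by blast

text \<open>The Euler forms A \<theta> - \<beta> lie in the fake indicial ideal, with 0 as the
  summand coming from the initial ideal.\<close>

lemma fake_exponent_euler:
  fixes v :: "complex^'n::finite"
  assumes "fake_exponent A \<beta> w v"
  shows "(\<Sum>j\<in>UNIV. of_int (A $ i $ j) * v $ j) = \<beta> $ i"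
proof -
  let ?f = "(\<Sum>j\<in>UNIV. cpoly_const (of_int (A $ i $ j)) * var j) - cpoly_const (\<beta> $ i)"
  have "theta_eval 0 (0 :: 'n weyl)"
    using theta_eval.const[of 0] by (simp add: weyl_const_def)
  then have "0 \<in> {f. \<exists>P \<in> left_ideal_gen (weyl_of_diff ` initial_ideal w (toric_ideal A)). theta_eval f P}"
    by (auto intro: left_ideal_gen.zero)
  moreover have "?f \<in> ideal_gen {(\<Sum>j\<in>UNIV. cpoly_const (of_int (A $ i $ j)) * var j) -
      cpoly_const (\<beta> $ i) | i. True}"
    by (rule ideal_gen_base) blast
  ultimately have "0 + ?f \<in> fake_indicial_ideal A \<beta> w"
    unfolding fake_indicial_ideal_def ideal_sum_def by blast
  then have "poly_eval ?f v = 0"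
    using assms unfolding fake_exponent_def by simp
  then show ?thesis
    by (simp add: poly_eval_minus poly_eval_sum poly_eval_const_mult_var poly_eval_const)
qed

text \<open>The embedding of \<complex>[\<partial>] is multiplicative, so the binomials suffice;
  \<partial>^a carries the coefficient at exponent v + a to exponent v.\<close>

lemma toric_annihilates_iff:
  "(\<forall>f\<in>toric_ideal A. \<forall>v. weyl_act (weyl_of_diff f) \<phi> v = 0) \<longleftrightarrow>
    (\<forall>a b v. A *v int_vec a = A *v int_vec b \<longrightarrow>
      log_diff_symbol (v + complex_vec (int_vec a)) a \<rhd> \<phi> (v + complex_vec (int_vec a)) =
      log_diff_symbol (v + complex_vec (int_vec b)) b \<rhd> \<phi> (v + complex_vec (int_vec b)))"
proof -
  let ?S = "{mon a - mon b | a b. A *v int_vec a = A *v int_vec b}"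
  have mon: "weyl_act (weyl_of_diff (mon a)) \<phi> v =
      log_diff_symbol (v + complex_vec (int_vec a)) a \<rhd> \<phi> (v + complex_vec (int_vec a))" for a v
    by (simp add: mon_def weyl_of_diff_single weyl_act_single weyl_term_def Let_def)
  have "(\<forall>f\<in>ideal_gen ?S. \<forall>v. weyl_act (weyl_of_diff f) \<phi> v = 0) \<longleftrightarrow>
      (\<forall>f\<in>?S. \<forall>v. weyl_act (weyl_of_diff f) \<phi> v = 0)"
  proof
    assume *: "\<forall>f\<in>?S. \<forall>v. weyl_act (weyl_of_diff f) \<phi> v = 0"
    have "\<forall>v. weyl_act (weyl_of_diff f) \<phi> v = 0" if "f \<in> ideal_gen ?S" for f
      using that
    proof (rule ideal_genE)
      fix c g f assume "g \<in> ?S" "\<forall>v. weyl_act (weyl_of_diff f) \<phi> v = 0"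
      with * show "\<forall>v. weyl_act (weyl_of_diff (c * g + f)) \<phi> v = 0"
        by (simp add: weyl_of_diff_add weyl_of_diff_mult weyl_act_add weyl_act_mult weyl_act_zero_series)
    qed simp
    then show "\<forall>f\<in>ideal_gen ?S. \<forall>v. weyl_act (weyl_of_diff f) \<phi> v = 0" by blast
  qed (blast intro: ideal_gen_base)
  also have "\<dots> \<longleftrightarrow> (\<forall>a b v. A *v int_vec a = A *v int_vec b \<longrightarrow>
      weyl_act (weyl_of_diff (mon a - mon b)) \<phi> v = 0)"
    by blast
  finally show ?thesis
    by (simp add: toric_ideal_def weyl_of_diff_minus weyl_act_minus mon)
qed

lemma hypergeometric_annihilates_iff:
  "(\<forall>P\<in>hypergeometric_ideal A \<beta>. \<forall>v. weyl_act P \<phi> v = 0) \<longleftrightarrow>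
    (\<forall>a b v. A *v int_vec a = A *v int_vec b \<longrightarrow>
      log_diff_symbol (v + complex_vec (int_vec a)) a \<rhd> \<phi> (v + complex_vec (int_vec a)) =
      log_diff_symbol (v + complex_vec (int_vec b)) b \<rhd> \<phi> (v + complex_vec (int_vec b))) \<and>
    (\<forall>i v. euler_symbol A i \<rhd> \<phi> v +
      cpoly_const ((\<Sum>j\<in>UNIV. of_int (A $ i $ j) * v $ j) - \<beta> $ i) * \<phi> v = 0)"
  unfolding hypergeometric_ideal_def weyl_act_left_ideal_gen ball_Un ball_simps
    toric_annihilates_iff weyl_act_euler_op euler_symbol_def by simp

lemma complex_vec_eq_iff [simp]: "complex_vec u = complex_vec u' \<longleftrightarrow> u = u'"
  by (simp add: complex_vec_def vec_eq_iff)

lemma euler_value_shift: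
  assumes "u \<in> ker_lattice A"
  shows "(\<Sum>j\<in>UNIV. of_int (A $ i $ j) * (v + complex_vec u) $ j) =
    (\<Sum>j\<in>UNIV. of_int (A $ i $ j) * v $ j)"
proof -
  have "(\<Sum>j\<in>UNIV. A $ i $ j * u $ j) = (A *v u) $ i"
    by (simp add: matrix_vector_mult_def)
  then have "of_int (\<Sum>j\<in>UNIV. A $ i $ j * u $ j) = (0 :: complex)"
    using assms by (simp add: ker_lattice_def)
  then show ?thesis
    by (simp add: complex_vec_def distrib_left sum.distrib)
qed

lemma nsupp_shift_antimono:
  "nsupp_shift v u \<subseteq> nsupp_shift v (u - int_vec b)"
proof
  fix j assume "j \<in> nsupp_shift v u"
  then have "neg_int (v $ j + of_int (u $ j) - of_nat (b $ j))"
    unfolding nsupp_shift_iff by (rule neg_int_minus_of_nat)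
  then show "j \<in> nsupp_shift v (u - int_vec b)"
    by (simp add: nsupp_shift_iff int_vec_def add_diff_eq)
qed

lemma ker_lattice_shift:
  "A *v int_vec a = A *v int_vec b \<Longrightarrow> t + int_vec a \<in> ker_lattice A \<longleftrightarrow> t + int_vec b \<in> ker_lattice A"
  by (simp add: ker_lattice_def matrix_vector_right_distrib)

text \<open>The lower bound is the coordinatewise minimum of u and u', which may lie outside the
  lattice. Each of its coordinates is that of u or of u', so its negative support stays in the
  union; lowering coordinates can only enlarge negative supports, which gives the other
  inclusion.\<close>

lemma common_lower_bound:
  assumes "u \<in> ker_lattice A" "u' \<in> ker_lattice A"
  obtains a b where "A *v int_vec a = A *v int_vec b" "u - int_vec a = u' - int_vec b"
    "nsupp_shift v (u - int_vec a) = nsupp_shift v u \<union> nsupp_shift v u'"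
proof
  define a where "a = (\<chi> j. nat (u $ j - u' $ j))"
  define b where "b = (\<chi> j. nat (u' $ j - u $ j))"
  show diff: "u - int_vec a = u' - int_vec b"
    by (simp add: vec_eq_iff int_vec_def a_def b_def)
  then have "int_vec a = u - u' + int_vec b" by (simp add: algebra_simps)
  then show "A *v int_vec a = A *v int_vec b"
    using assms by (simp add: ker_lattice_def matrix_vector_right_distrib matrix_vector_mult_diff_distrib)
  have "nsupp_shift v (u - int_vec a) \<subseteq> nsupp_shift v u \<union> nsupp_shift v u'"
  proof
    fix j assume j: "j \<in> nsupp_shift v (u - int_vec a)"
    have "(u - int_vec a) $ j = u $ j \<or> (u - int_vec a) $ j = u' $ j"
      by (auto simp: int_vec_def a_def)
    with j show "j \<in> nsupp_shift v u \<union> nsupp_shift v u'" unfolding Un_iff nsupp_shift_iff by metis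
  qed
  then show "nsupp_shift v (u - int_vec a) = nsupp_shift v u \<union> nsupp_shift v u'"
    using nsupp_shift_antimono[of v u a] nsupp_shift_antimono[of v u' b] unfolding diff by blast
qed

section \<open>Solutions and the polynomials killed by Q\<close>

context
  fixes A :: "int^'n::finite^'d::finite" and \<beta> :: "complex^'d" and v :: "complex^'n" and N
  assumes exponent: "\<And>i. (\<Sum>j\<in>UNIV. of_int (A $ i $ j) * v $ j) = \<beta> $ i"
    and zero_mem: "nsupp_shift v 0 \<in> N" and sub_NS: "N \<subseteq> NS A v"
begin

lemma K_set_sub: "I \<in> N \<Longrightarrow> K_set N \<subseteq> I"
  by (auto simp: K_set_def)

text \<open>One representative for each negative support suffices to build p: the toric equations
  compare any two representatives through their common lower bound.\<close>

lemma solution_glue: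
  assumes supp: "\<And>x. \<phi> x \<noteq> 0 \<Longrightarrow> \<exists>u \<in> ker_lattice A. x = v + complex_vec u \<and> nsupp_shift v u \<in> N"
    and ann: "\<forall>P \<in> hypergeometric_ideal A \<beta>. \<forall>x. weyl_act P \<phi> x = 0"
  shows "\<exists>p\<in>sol_space (Q_ideal A v N). \<phi> v = m_mon v N \<rhd> p"
proof -
  \<comment> \<open>The representative of the support of v itself is taken to be 0, so that the
    coefficient picked there is \<open>\<phi> v\<close>.\<close>
  have "\<forall>I\<in>NS A v. \<exists>u. u \<in> ker_lattice A \<and> nsupp_shift v u = I \<and> (I = nsupp_shift v 0 \<longrightarrow> u = 0)"
  proof
    fix I assume "I \<in> NS A v"
    then obtain u where u: "u \<in> ker_lattice A" "nsupp_shift v u = I" by (auto simp: NS_def)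
    have "0 \<in> ker_lattice A" by (simp add: ker_lattice_def)
    with u show "\<exists>u. u \<in> ker_lattice A \<and> nsupp_shift v u = I \<and> (I = nsupp_shift v 0 \<longrightarrow> u = 0)"
      by (cases "I = nsupp_shift v 0") blast+
  qed
  then obtain r where r: "\<And>I. I \<in> NS A v \<Longrightarrow> r I \<in> ker_lattice A"
    "\<And>I. I \<in> NS A v \<Longrightarrow> nsupp_shift v (r I) = I" "nsupp_shift v 0 \<in> NS A v \<Longrightarrow> r (nsupp_shift v 0) = 0"
    by metis
  define \<psi> where "\<psi> I = \<phi> (v + complex_vec (r I))" for I
  \<comment> \<open>The index type has finitely many subsets, so a single k bounds the degrees of
    all chosen coefficients.\<close>
  obtain k where "\<forall>p\<in>range \<psi>. deg_less k p" using ex_deg_less[of "range \<psi>"] by auto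
  then have k: "deg_less k (\<psi> I)" for I by blast
  define q where "q I = gamma_unit_vec_inv k v (r I) \<rhd> \<psi> I" for I
  have q_deg: "deg_less k (q I)" for I unfolding q_def by (intro deg_less_diff_act k)
  have \<psi>_q: "\<psi> I = gamma_unit_vec k v (r I) \<rhd> q I" for I
    unfolding q_def by (rule gamma_unit_vec_cancel(1)[OF k, symmetric])
  note hyp = ann[unfolded hypergeometric_annihilates_iff]
  have compat: "sqfree_mon (J - I) \<rhd> q I = sqfree_mon (I - J) \<rhd> q J"
    if I: "I \<in> NS A v" and J: "J \<in> NS A v" for I J
  proof -
    obtain a b where ab: "A *v int_vec a = A *v int_vec b" "r I - int_vec a = r J - int_vec b"
      "nsupp_shift v (r I - int_vec a) = nsupp_shift v (r I) \<union> nsupp_shift v (r J)"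
      using common_lower_bound[OF r(1)[OF I] r(1)[OF J]] by metis
    define t where "t = r I - int_vec a"
    have "r I = t + int_vec a" unfolding t_def by simp
    moreover have "r J = t + int_vec b" unfolding t_def ab(2) by simp
    moreover have "nsupp_shift v t = I \<union> J" unfolding t_def ab(3) r(2)[OF I] r(2)[OF J] ..
    ultimately have t: "r I = t + int_vec a" "r J = t + int_vec b" "nsupp_shift v t = I \<union> J"
      by blast+
    let ?U = "gamma_unit_vec k v t"
    have side: "log_diff_symbol (v + complex_vec t + complex_vec (int_vec c)) c \<rhd>
        \<phi> (v + complex_vec t + complex_vec (int_vec c)) = ?U \<rhd> sqfree_mon (I \<union> J - L) \<rhd> q L"
      if c: "r L = t + int_vec c" "L \<in> NS A v" for c L
    proof -
      have x: "v + complex_vec t + complex_vec (int_vec c) = v + complex_vec (r L)"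
        by (simp add: c(1) complex_vec_add add.assoc)
      have e: "r L - int_vec c = t" by (simp add: c(1))
      have "log_diff_symbol (v + complex_vec (r L)) c \<rhd> \<phi> (v + complex_vec (r L)) =
          (log_diff_symbol (v + complex_vec (r L)) c * gamma_unit_vec k v (r L)) \<rhd> q L"
        unfolding diff_act_mult \<psi>_q[symmetric] \<psi>_def ..
      also have "\<dots> = (sqfree_mon (nsupp_shift v (r L - int_vec c) - nsupp_shift v (r L)) *
          gamma_unit_vec k v (r L - int_vec c)) \<rhd> q L"
        by (rule act_eqD[OF log_diff_symbol_gamma_unit_vec q_deg])
      also have "\<dots> = ?U \<rhd> sqfree_mon (I \<union> J - L) \<rhd> q L"
        unfolding e t(3) r(2)[OF c(2)] diff_act_mult by (rule diff_act_commute)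
      finally show ?thesis by (simp only: x)
    qed
    \<comment> \<open>The two sides of the toric equation at exponent v + t carry the same unit,
      which is cancelled next.\<close>
    have "?U \<rhd> sqfree_mon (I \<union> J - I) \<rhd> q I = ?U \<rhd> sqfree_mon (I \<union> J - J) \<rhd> q J"
      unfolding side[OF t(1) I, symmetric] side[OF t(2) J, symmetric] using hyp ab(1) by blast
    then have "gamma_unit_vec_inv k v t \<rhd> ?U \<rhd> sqfree_mon (I \<union> J - I) \<rhd> q I =
        gamma_unit_vec_inv k v t \<rhd> ?U \<rhd> sqfree_mon (I \<union> J - J) \<rhd> q J"
      by (rule arg_cong)
    then have "sqfree_mon (I \<union> J - I) \<rhd> q I = sqfree_mon (I \<union> J - J) \<rhd> q J"
      by (simp only: gamma_unit_vec_cancel(2) deg_less_diff_act q_deg)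
    moreover have "I \<union> J - I = J - I" "I \<union> J - J = I - J" by auto
    ultimately show ?thesis by (simp only:)
  qed
  have q0: "q J = 0" if J: "J \<in> NS A v - N" for J
  proof -
    have "\<phi> (v + complex_vec (r J)) = 0"
    proof (rule ccontr)
      assume "\<phi> (v + complex_vec (r J)) \<noteq> 0"
      from supp[OF this] have "nsupp_shift v (r J) \<in> N" by auto
      with r(2)[of J] J show False by simp
    qed
    then show ?thesis by (simp add: q_def \<psi>_def)
  qed
  obtain p where p: "\<And>I. I \<in> N \<Longrightarrow> sqfree_mon (I - K_set N) \<rhd> p = q I"
    using sqfree_mon_glue[of N "K_set N" q] compat sub_NS K_set_sub by blast
  have "p \<in> sol_space (Q_ideal A v N)"
    unfolding sol_space_Q_ideal
  proof (intro conjI allI ballI)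
    \<comment> \<open>Lattice shifts do not change the Euler scalar, so the equation becomes A
      \<partial>_y \<psi> = 0; the inverse unit commutes with A \<partial>_y.\<close>
    fix i I assume I: "I \<in> N"
    have "r I \<in> ker_lattice A" using r(1) I sub_NS by blast
    then have "(\<Sum>j\<in>UNIV. of_int (A $ i $ j) * (v + complex_vec (r I)) $ j) - \<beta> $ i = 0"
      by (simp only: euler_value_shift exponent diff_self)
    moreover have "euler_symbol A i \<rhd> \<psi> I + cpoly_const ((\<Sum>j\<in>UNIV. of_int (A $ i $ j) *
        (v + complex_vec (r I)) $ j) - \<beta> $ i) * \<psi> I = 0"
      unfolding \<psi>_def using hyp by blast
    ultimately have "euler_symbol A i \<rhd> \<psi> I = 0"
      by (simp only: cpoly_const_0 mult_zero_left add_0_right)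
    then have "gamma_unit_vec_inv k v (r I) \<rhd> euler_symbol A i \<rhd> \<psi> I = 0" by simp
    then show "euler_symbol A i \<rhd> sqfree_mon (I - K_set N) \<rhd> p = 0"
      unfolding p[OF I] q_def by (simp only: diff_act_commute[of "euler_symbol A i"])
  next
    fix I J assume I: "I \<in> N" and J: "J \<in> NS A v - N"
    \<comment> \<open>The set (I \<union> J) - K is split at I, and compatibility moves the
      remaining operator onto \<open>q J\<close>, which is 0.\<close>
    have "sqfree_mon (I \<union> J - K_set N) \<rhd> p = sqfree_mon (I \<union> J - I) \<rhd> q I"
      using sqfree_mon_diff_trans[OF K_set_sub[OF I], of "I \<union> J"] p[OF I] by (simp add: diff_act_mult)
    also have "I \<union> J - I = J - I" by auto
    also have "sqfree_mon (J - I) \<rhd> q I = 0"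
      using compat[of I J] q0[OF J] I J sub_NS by auto
    finally show "sqfree_mon (I \<union> J - K_set N) \<rhd> p = 0" .
  qed
  moreover have "\<phi> v = m_mon v N \<rhd> p"
  proof -
    have "r (nsupp_shift v 0) = 0" using r(3) zero_mem sub_NS by blast
    then have "\<phi> v = q (nsupp_shift v 0)" by (simp add: q_def \<psi>_def)
    then show ?thesis using p[OF zero_mem] by (simp add: m_mon_def)
  qed
  ultimately show ?thesis by blast
qed

text \<open>Reverses the gluing: every lattice vector u whose support lies in \<open>N\<close>
  receives the matching derivative of p, multiplied by the unit of u.\<close>

lemma solution_exists:
  assumes p: "p \<in> sol_space (Q_ideal A v N)"
  shows "\<exists>\<phi>. \<phi> v = m_mon v N \<rhd> p \<and>
    (\<forall>x. \<phi> x \<noteq> 0 \<longrightarrow> (\<exists>u \<in> ker_lattice A. x = v + complex_vec u \<and> nsupp_shift v u \<in> N)) \<and>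
    (\<forall>P \<in> hypergeometric_ideal A \<beta>. \<forall>x. weyl_act P \<phi> x = 0)"
proof -
  obtain k where k: "deg_less k p" using ex_deg_less[of "{p}"] by auto
  define \<psi> where "\<psi> u = (if u \<in> ker_lattice A \<and> nsupp_shift v u \<in> N
    then gamma_unit_vec k v u \<rhd> sqfree_mon (nsupp_shift v u - K_set N) \<rhd> p else 0)" for u
  \<comment> \<open>Series are indexed by complex exponents; the vector u is unique because
    \<open>complex_vec\<close> is injective.\<close>
  define \<phi> where "\<phi> x = (if \<exists>u. x = v + complex_vec u
    then \<psi> (THE u. x = v + complex_vec u) else 0)" for x
  have \<phi>: "\<phi> (v + complex_vec u) = \<psi> u" for u
    by (auto simp: \<phi>_def)
  have supp: "\<exists>u \<in> ker_lattice A. x = v + complex_vec u \<and> nsupp_shift v u \<in> N" if "\<phi> x \<noteq> 0" for x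
  proof -
    from that obtain u where u: "x = v + complex_vec u" by (auto simp: \<phi>_def split: if_splits)
    with that \<phi> have "\<psi> u \<noteq> 0" by simp
    with u show ?thesis by (auto simp: \<psi>_def split: if_splits)
  qed
  have toric: "log_diff_symbol (x + complex_vec (int_vec a)) a \<rhd> \<phi> (x + complex_vec (int_vec a)) =
      log_diff_symbol (x + complex_vec (int_vec b)) b \<rhd> \<phi> (x + complex_vec (int_vec b))"
    if ab: "A *v int_vec a = A *v int_vec b" for a b x
  proof (cases "\<exists>t. x = v + complex_vec t")
    case False
    have "\<phi> (x + complex_vec (int_vec c)) = 0" for c
    proof (rule ccontr)
      assume "\<phi> (x + complex_vec (int_vec c)) \<noteq> 0"
      from supp[OF this] obtain u where "x + complex_vec (int_vec c) = v + complex_vec u" by blast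
      then have "x = v + complex_vec (u - int_vec c)" by (simp add: complex_vec_minus algebra_simps)
      with False show False by blast
    qed
    then show ?thesis by simp
  next
    case True
    then obtain t where t: "x = v + complex_vec t" by blast
    let ?T = "nsupp_shift v t" and ?U = "gamma_unit_vec k v t"
    \<comment> \<open>The nonzero value is the same for all c: the derivative from the support of
      \<open>?u\<close> up to \<open>?T\<close> is completed by the toric operator.\<close>
    have eval: "log_diff_symbol (x + complex_vec (int_vec c)) c \<rhd> \<phi> (x + complex_vec (int_vec c)) =
        (if t + int_vec c \<in> ker_lattice A \<and> nsupp_shift v (t + int_vec c) \<in> N
          then ?U \<rhd> sqfree_mon (?T - K_set N) \<rhd> p else 0)" for c
    proof -
      let ?u = "t + int_vec c"
      have x: "x + complex_vec (int_vec c) = v + complex_vec ?u"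
        by (simp add: t complex_vec_add add.assoc)
      show ?thesis
      proof (cases "?u \<in> ker_lattice A \<and> nsupp_shift v ?u \<in> N")
        case True
        let ?I = "nsupp_shift v ?u"
        have "?I \<subseteq> ?T" using nsupp_shift_antimono[of v ?u c] by simp
        then have "sqfree_mon (?T - K_set N) = sqfree_mon (?T - ?I) * sqfree_mon (?I - K_set N)"
          using True K_set_sub by (intro sqfree_mon_diff_trans) auto
        moreover have "log_diff_symbol (v + complex_vec ?u) c \<rhd> \<psi> ?u =
            (sqfree_mon (?T - ?I) * ?U) \<rhd> sqfree_mon (?I - K_set N) \<rhd> p"
          using act_eqD[OF log_diff_symbol_gamma_unit_vec[of k v ?u c]
              deg_less_diff_act[OF k, of "sqfree_mon (?I - K_set N)"]] True
          by (simp add: \<psi>_def diff_act_mult)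
        ultimately show ?thesis
          unfolding x \<phi> if_P[OF True] by (simp only: diff_act_mult diff_act_commute[of ?U])
      next
        case False
        then show ?thesis unfolding x \<phi> \<psi>_def if_not_P[OF False] by simp
      qed
    qed
    \<comment> \<open>The two sides can differ only when one support lies in \<open>N\<close> and
      the other does not. \<open>?T\<close> contains their union, so its monomial is a multiple of a
      generator of \<open>P_ideal\<close>, which kills p.\<close>
    have kill: "sqfree_mon (?T - K_set N) \<rhd> p = 0"
      if I: "nsupp_shift v (t + int_vec c) \<in> N"
        and J: "t + int_vec c' \<in> ker_lattice A" "nsupp_shift v (t + int_vec c') \<notin> N" for c c'
    proof -
      let ?I = "nsupp_shift v (t + int_vec c)" and ?J = "nsupp_shift v (t + int_vec c')"
      have "?I \<subseteq> ?T" "?J \<subseteq> ?T"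
        using nsupp_shift_antimono[of v "t + int_vec c" c] nsupp_shift_antimono[of v "t + int_vec c'" c']
        by simp_all
      then have "sqfree_mon (?T - K_set N) = sqfree_mon (?T - (?I \<union> ?J)) * sqfree_mon (?I \<union> ?J - K_set N)"
        using K_set_sub[OF I] by (intro sqfree_mon_diff_trans) auto
      moreover have "?J \<in> NS A v - N" using J by (simp add: NS_def)
      then have "sqfree_mon (?I \<union> ?J - K_set N) \<rhd> p = 0"
        using p I unfolding sol_space_Q_ideal by blast
      ultimately show ?thesis by (simp add: diff_act_mult)
    qed
    show ?thesis
      unfolding eval using ker_lattice_shift[OF ab, of t] kill[of a b] kill[of b a] by auto
  qed
  have euler: "euler_symbol A i \<rhd> \<phi> x +
      cpoly_const ((\<Sum>j\<in>UNIV. of_int (A $ i $ j) * x $ j) - \<beta> $ i) * \<phi> x = 0" for i x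
  proof (cases "\<phi> x = 0")
    case False
    from supp[OF this] obtain u where u: "u \<in> ker_lattice A" "x = v + complex_vec u" "nsupp_shift v u \<in> N"
      by blast
    have "euler_symbol A i \<rhd> sqfree_mon (nsupp_shift v u - K_set N) \<rhd> p = 0"
      using p u(3) unfolding sol_space_Q_ideal by blast
    then have "gamma_unit_vec k v u \<rhd> euler_symbol A i \<rhd> sqfree_mon (nsupp_shift v u - K_set N) \<rhd> p = 0"
      by simp
    then have "euler_symbol A i \<rhd> \<psi> u = 0"
      using u by (simp add: \<psi>_def diff_act_commute[of "euler_symbol A i" "gamma_unit_vec k v u"])
    moreover have "(\<Sum>j\<in>UNIV. of_int (A $ i $ j) * x $ j) - \<beta> $ i = 0"
      unfolding u(2) euler_value_shift[OF u(1)] exponent by simp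
    ultimately show ?thesis unfolding u(2) \<phi> by simp
  qed simp
  have "\<phi> v = \<psi> 0" using \<phi>[of 0] by simp
  then have "\<phi> v = m_mon v N \<rhd> p"
    using zero_mem by (simp add: \<psi>_def ker_lattice_def m_mon_def)
  moreover have "\<forall>P \<in> hypergeometric_ideal A \<beta>. \<forall>x. weyl_act P \<phi> x = 0"
    unfolding hypergeometric_annihilates_iff using toric euler by blast
  ultimately show ?thesis using supp by blast
qed

lemma coeff_space_eq_image:
  "coeff_space A \<beta> v N = (\<lambda>p. m_mon v N \<rhd> p) ` sol_space (Q_ideal A v N)"
proof
  show "coeff_space A \<beta> v N \<subseteq> (\<lambda>p. m_mon v N \<rhd> p) ` sol_space (Q_ideal A v N)"
  proof
    fix f assume "f \<in> coeff_space A \<beta> v N"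
    then obtain \<phi> where \<phi>: "f = \<phi> v"
      "\<And>x. \<phi> x \<noteq> 0 \<Longrightarrow> \<exists>u \<in> ker_lattice A. x = v + complex_vec u \<and> nsupp_shift v u \<in> N"
      "\<forall>P \<in> hypergeometric_ideal A \<beta>. \<forall>x. weyl_act P \<phi> x = 0"
      unfolding coeff_space_def by blast
    from solution_glue[OF \<phi>(2,3)] \<phi>(1) show "f \<in> (\<lambda>p. m_mon v N \<rhd> p) ` sol_space (Q_ideal A v N)"
      by blast
  qed
  show "(\<lambda>p. m_mon v N \<rhd> p) ` sol_space (Q_ideal A v N) \<subseteq> coeff_space A \<beta> v N"
  proof
    fix f assume "f \<in> (\<lambda>p. m_mon v N \<rhd> p) ` sol_space (Q_ideal A v N)"
    then obtain p where p: "p \<in> sol_space (Q_ideal A v N)" "f = m_mon v N \<rhd> p" by blast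
    from solution_exists[OF p(1)] obtain \<phi> where \<phi>: "\<phi> v = f"
      "\<forall>x. \<phi> x \<noteq> 0 \<longrightarrow> (\<exists>u \<in> ker_lattice A. x = v + complex_vec u \<and> nsupp_shift v u \<in> N)"
      "\<forall>P \<in> hypergeometric_ideal A \<beta>. \<forall>x. weyl_act P \<phi> x = 0"
      unfolding p(2)[symmetric] by blast
    show "f \<in> coeff_space A \<beta> v N"
      unfolding coeff_space_def by (rule CollectI, rule exI[of _ \<phi>]) (use \<phi> in simp)
  qed
qed

end

theorem theorem4p7:
  fixes A :: "int^'n::finite^'d::finite"
    and \<beta> :: "complex^'d"
    and w :: "real^'n"
    and v\<^sub>0 :: "complex^'n"
    and N :: "'n set set"
  assumes "admissible_matrix A"
    and "generic_weight A w"
    and "fake_exponent A \<beta> w v\<^sub>0"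
    and "neg_supp_family A w v\<^sub>0 N"
    and "ordered_family A v\<^sub>0 N"
  shows "annihilator (coeff_space A \<beta> v\<^sub>0 N) = ideal_colon (Q_ideal A v\<^sub>0 N) (m_mon v\<^sub>0 N) \<and>
    coeff_space A \<beta> v\<^sub>0 N = perp_space (ideal_colon (Q_ideal A v\<^sub>0 N) (m_mon v\<^sub>0 N)) \<and>
    perp_space (ideal_colon (Q_ideal A v\<^sub>0 N) (m_mon v\<^sub>0 N)) =
      sol_space (ideal_colon (Q_ideal A v\<^sub>0 N) (m_mon v\<^sub>0 N))"
proof -
  let ?Q = "Q_ideal A v\<^sub>0 N" and ?m = "m_mon v\<^sub>0 N"
  have "nsupp_shift v\<^sub>0 0 \<in> N" "N \<subseteq> NS A v\<^sub>0"
    using assms(4) by (auto simp: neg_supp_family_def NS_nonneg_def)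
  then have C: "coeff_space A \<beta> v\<^sub>0 N = (\<lambda>p. ?m \<rhd> p) ` sol_space ?Q"
    by (intro coeff_space_eq_image fake_exponent_euler[OF assms(3)])
  have "homogeneous (card (nsupp_shift v\<^sub>0 0 - K_set N)) ?m"
    unfolding m_mon_def by (rule homogeneous_sqfree_mon)
  with C have "coeff_space A \<beta> v\<^sub>0 N = sol_space (ideal_colon ?Q ?m)"
    by (simp add: sol_space_colon[OF subspace_Q_ideal trunc_Q_ideal])
  \<comment> \<open>Ann(m \<bullet> V) = Ann(V) : m, applied to V = Sol(Q), whose annihilator is
    Q.\<close>
  moreover have "annihilator (coeff_space A \<beta> v\<^sub>0 N) = ideal_colon ?Q ?m"
    unfolding C annihilator_image
    by (simp only: annihilator_sol_space[OF subspace_Q_ideal trunc_Q_ideal])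
  moreover have "perp_space (ideal_colon ?Q ?m) = sol_space (ideal_colon ?Q ?m)"
    by (intro perp_space_eq_sol_space subspace_ideal_colon subspace_Q_ideal)
  ultimately show ?thesis by simp
qed

end
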